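(* Let $\mathcal{A}$ be a $C^*$-algebra which is not unital but is locally unital. Then $\mathcal{A}$, regarded as a Hilbert $C^*$-module over itself, has no frames (neither standard nor non-standard): there is no family $\{x_j\}_{j\in J}$ of elements of $\mathcal{A}$, indexed by any set $J$, that is a frame in $\mathcal{A}$.
   Context: A self-adjoint element $h\in\mathcal{A}$ is a local unit for $a\in\mathcal{A}$ if $ah=ha=a$ ($h$ need not be idempotent). A $C^*$-algebra $\mathcal{A}$ is locally unital if every $a\in\mathcal{A}$ has a local unit in $\mathcal{A}$. $\dot{\mathcal{A}}$ denotes the unitalization of $\mathcal{A}$ (equal to $\mathcal{A}$ if $\mathcal{A}$ is unital). $\mathcal{A}$ is a right Hilbert module over itself and over $\dot{\mathcal{A}}$, with inner product $\langle a,b\rangle=a^*b$. When $\mathcal{A}$ is not unital, frames in $\mathcal{A}$ are understood with $\mathcal{A}$ regarded as a Hilbert $\dot{\mathcal{A}}$-module. Frame: let $\mathcal{N}$ be a Hilbert $C^*$-module over a unital $C^*$-algebra $\mathcal{B}$. A family $\{x_j\}_{j\in J}\subset\mathcal{N}$ is a standard frame if there are constants $c_1,c_2>0$ such that for every $x\in\mathcal{N}$ the series $\sum_j\langle x,x_j\rangle\langle x_j,x\rangle$ converges in norm and $c_1\langle x,x\rangle\le\sum_j\langle x,x_j\rangle\langle x_j,x\rangle\le c_2\langle x,x\rangle$. If the series (as the net of its finite partial sums) is only required to converge in the ultraweak ($\sigma$-weak) topology (of the universal enveloping von Neumann algebra of $\mathcal{B}$), the family is a non-standard frame. "Frame" means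 at least a non-standard frame. Equivalently (a known criterion), $\{x_j\}_{j\in J}$ is a frame iff there are $c_1,c_2>0$ with $c_1\varphi(\langle x,x\rangle)\le\sum_{j}\varphi(\langle x,x_j\rangle\langle x_j,x\rangle)\le c_2\varphi(\langle x,x\rangle)$ for all $x\in\mathcal{N}$ and all states $\varphi$ of $\mathcal{B}$. *)

theory Defs
  imports "HOL-Analysis.Analysis"
begin

section \<open>$C^*$-algebras\<close>

class scaleC =
  fixes scaleC :: "complex \<Rightarrow> 'a \<Rightarrow> 'a"  (infixr \<open>*\<^sub>C\<close> 75)

class complex_normed_vector = real_normed_vector + scaleC +
  assumes scaleC_add_right: "c *\<^sub>C (x + y) = c *\<^sub>C x + c *\<^sub>C y"
    and scaleC_add_left: "(c + d) *\<^sub>C x = c *\<^sub>C x + d *\<^sub>C x"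
    and scaleC_scaleC [simp]: "c *\<^sub>C d *\<^sub>C x = (c * d) *\<^sub>C x"
    and scaleC_of_real: "complex_of_real r *\<^sub>C x = r *\<^sub>R x"
    and norm_scaleC [simp]: "norm (c *\<^sub>C x) = cmod c * norm x"

class star =
  fixes star :: "'a \<Rightarrow> 'a"

text \<open>No unit is assumed.  The class \<open>real_normed_algebra\<close> supplies the ring structure and
  submultiplicativity of the norm, \<open>banach\<close> supplies completeness.\<close>

class cstar_algebra = complex_normed_vector + banach + real_normed_algebra + star +
  assumes mult_scaleC_left [simp]: "(c *\<^sub>C x) * y = c *\<^sub>C (x * y)"
    and mult_scaleC_right [simp]: "x * (c *\<^sub>C y) = c *\<^sub>C (x * y)"
    and star_add [simp]: "star (x + y) = star x + star y"
    and star_scaleC [simp]: "star (c *\<^sub>C x) = cnj c *\<^sub>C star x"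
    and star_mult [simp]: "star (x * y) = star y * star x"
    and star_star [simp]: "star (star x) = x"
    and cstar_identity: "norm (star x * x) = (norm x)\<^sup>2"

text \<open>The axiom \<open>0 \<noteq> 1\<close> is deliberately absent, so that the zero algebra is unital.\<close>

class unital_cstar_algebra = cstar_algebra + monoid_mult

definition unital :: "'a::cstar_algebra itself \<Rightarrow> bool" where
  "unital _ \<longleftrightarrow> (\<exists>e::'a. \<forall>a. e * a = a \<and> a * e = a)"

definition local_unit :: "'a::cstar_algebra \<Rightarrow> 'a \<Rightarrow> bool" where
  "local_unit h a \<longleftrightarrow> star h = h \<and> a * h = a \<and> h * a = a"

definition locally_unital :: "'a::cstar_algebra itself \<Rightarrow> bool" where
  "locally_unital _ \<longleftrightarrow> (\<forall>a::'a. \<exists>h. local_unit h a)"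

definition cstar_le :: "'a::cstar_algebra \<Rightarrow> 'a \<Rightarrow> bool"  (infix \<open>\<le>\<^sub>*\<close> 50) where
  "a \<le>\<^sub>* b \<longleftrightarrow> (\<exists>c. b - a = star c * c)"

lemma scaleC_one [simp]: "1 *\<^sub>C x = (x::'a::complex_normed_vector)"
  using scaleC_of_real[of 1 x] by simp

lemma scaleC_zero_left [simp]: "0 *\<^sub>C x = (0::'a::complex_normed_vector)"
  using scaleC_of_real[of 0 x] by simp

lemma scaleC_zero_right [simp]: "c *\<^sub>C 0 = (0::'a::complex_normed_vector)"
  using norm_scaleC[of c "0::'a"] by (simp del: norm_scaleC)

lemma scaleC_minus_right [simp]: "c *\<^sub>C (- x) = - (c *\<^sub>C (x::'a::complex_normed_vector))"
  using scaleC_add_right[of c x "-x"] by (simp add: eq_neg_iff_add_eq_0 add.commute)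

lemma scaleC_diff_right: "c *\<^sub>C (x - y) = c *\<^sub>C x - c *\<^sub>C (y::'a::complex_normed_vector)"
  using scaleC_add_right[of c x "-y"] by simp

lemma scaleC_diff_left: "(c - d) *\<^sub>C x = c *\<^sub>C x - d *\<^sub>C (x::'a::complex_normed_vector)"
  using scaleC_add_left[of "c - d" d x] by (simp add: algebra_simps)

lemma scaleC_minus_left [simp]: "(- c) *\<^sub>C x = - (c *\<^sub>C (x::'a::complex_normed_vector))"
  using scaleC_diff_left[of 0 c x] by simp

lemma scaleR_scaleC: "r *\<^sub>R c *\<^sub>C x = (complex_of_real r * c) *\<^sub>C (x::'a::complex_normed_vector)"
  by (simp flip: scaleC_of_real)

lemma scaleC_scaleR: "c *\<^sub>C r *\<^sub>R x = (complex_of_real r * c) *\<^sub>C (x::'a::complex_normed_vector)"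
  by (simp add: mult.commute flip: scaleC_of_real)

lemma star_zero [simp]: "star (0::'a::cstar_algebra) = 0"
  using star_add[of "0::'a" 0] by simp

lemma star_minus [simp]: "star (- x) = - star (x::'a::cstar_algebra)"
  using star_add[of x "-x"] by (simp add: eq_neg_iff_add_eq_0 add.commute)

lemma star_diff [simp]: "star (x - y) = star x - star (y::'a::cstar_algebra)"
  using star_add[of x "-y"] by simp

lemma star_scaleR [simp]: "star (r *\<^sub>R x) = r *\<^sub>R star (x::'a::cstar_algebra)"
  using star_scaleC[of "of_real r" x] by (simp add: scaleC_of_real)

lemma norm_star [simp]: "norm (star x) = norm (x::'a::cstar_algebra)"
proof -
  have le: "norm y \<le> norm (star y)" for y :: 'a
  proof (cases "y = 0")
    case False
    have "norm y * norm y \<le> norm (star y) * norm y"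
      using norm_mult_ineq[of "star y" y] by (simp add: cstar_identity power2_eq_square)
    then show ?thesis using False by simp
  qed auto
  show ?thesis using le[of x] le[of "star x"] by simp
qed

lemma star_mult_self_eq_0 [simp]: "star x * x = 0 \<longleftrightarrow> x = (0::'a::cstar_algebra)"
  using cstar_identity[of x] by auto

lemma bounded_linear_scaleC: "bounded_linear (\<lambda>x::'a::complex_normed_vector. c *\<^sub>C x)"
  by (rule bounded_linear_intro[where K = "cmod c"])
     (simp_all add: scaleC_add_right scaleC_scaleR scaleR_scaleC mult.commute)


section \<open>The unitalization\<close>

text \<open>The operators $x \mapsto ax + cx$ on the algebra, with the operator norm.  If the algebra
  is not unital, the representation of an operator by the pair $(a,c)$ is unique and this is the
  usual $\mathcal A \oplus \mathbb C$; if it is unital, all these operators are left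
  multiplications, so that nothing is added.\<close>

typedef (overloaded) 'a unitalization =
  "{T :: 'a::cstar_algebra \<Rightarrow> 'a. \<exists>a c. T = (\<lambda>x. a * x + c *\<^sub>C x)}"
  morphisms uapply Abs_unitalization
  by blast

setup_lifting type_definition_unitalization

lift_definition of_alg_scalar :: "'a::cstar_algebra \<Rightarrow> complex \<Rightarrow> 'a unitalization"
  is "\<lambda>a c x. a * x + c *\<^sub>C x" by blast

definition of_alg :: "'a::cstar_algebra \<Rightarrow> 'a unitalization" where
  "of_alg a = of_alg_scalar a 0"

lemma uapply_of_alg_scalar [simp]: "uapply (of_alg_scalar a c) x = a * x + c *\<^sub>C x"
  by transfer simp

lemma uapply_of_alg [simp]: "uapply (of_alg a) x = a * x"
  by (simp add: of_alg_def)

lemma unitalization_cases [case_names of_alg_scalar, cases type: unitalization]: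
  obtains a c where "T = of_alg_scalar a c"
  by (transfer fixing: thesis) blast

lemma unitalization_eqI: "(\<And>x. uapply S x = uapply T x) \<Longrightarrow> S = T"
  by (metis uapply_inject ext)

lemma bounded_linear_uapply: "bounded_linear (uapply T)"
proof (cases T)
  case (of_alg_scalar a c)
  then have "uapply T = (\<lambda>x. a * x + c *\<^sub>C x)" by auto
  then show ?thesis
    using bounded_linear_add[OF bounded_linear_mult_right bounded_linear_scaleC] by metis
qed

lemmas uapply_add = bounded_linear.linear[OF bounded_linear_uapply, THEN linear_add]

instantiation unitalization :: (cstar_algebra) complex_normed_vector
begin

lift_definition zero_unitalization :: "'a unitalization" is "\<lambda>x. 0"
  by (rule exI[of _ 0], rule exI[of _ 0]) simp
lift_definition plus_unitalization :: "'a unitalization \<Rightarrow> 'a unitalization \<Rightarrow> 'a unitalization"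
  is "\<lambda>S T x. S x + T x"
proof (elim exE, goal_cases)
  case (1 S T a b c d)
  then show ?case
    by (intro exI[of _ "a + b"] exI[of _ "c + d"])
       (simp add: algebra_simps scaleC_add_left)
qed
lift_definition uminus_unitalization :: "'a unitalization \<Rightarrow> 'a unitalization"
  is "\<lambda>T x. - T x"
proof (elim exE, goal_cases)
  case (1 T a c)
  then show ?case
    by (intro exI[of _ "- a"] exI[of _ "- c"]) simp
qed
definition minus_unitalization :: "'a unitalization \<Rightarrow> 'a unitalization \<Rightarrow> 'a unitalization"
  where "S - T = S + (- T :: 'a unitalization)"
lift_definition scaleC_unitalization :: "complex \<Rightarrow> 'a unitalization \<Rightarrow> 'a unitalization"
  is "\<lambda>k T x. k *\<^sub>C T x"
proof (elim exE, goal_cases)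
  case (1 k T a c)
  then show ?case
    by (intro exI[of _ "k *\<^sub>C a"] exI[of _ "k * c"]) (simp add: scaleC_add_right)
qed
definition scaleR_unitalization :: "real \<Rightarrow> 'a unitalization \<Rightarrow> 'a unitalization"
  where "scaleR_unitalization r T = complex_of_real r *\<^sub>C T"
definition norm_unitalization :: "'a unitalization \<Rightarrow> real"
  where "norm_unitalization T = onorm (uapply T)"
definition sgn_unitalization :: "'a unitalization \<Rightarrow> 'a unitalization"
  where "sgn_unitalization T = scaleR (inverse (norm T)) T"
definition dist_unitalization :: "'a unitalization \<Rightarrow> 'a unitalization \<Rightarrow> real"
  where "dist_unitalization S T = norm (S - T)"
definition uniformity_unitalization :: "('a unitalization \<times> 'a unitalization) filter"
  where "uniformity_unitalization = (INF e\<in>{0 <..}. principal {(x, y). dist x y < e})"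
definition open_unitalization :: "'a unitalization set \<Rightarrow> bool"
  where "open_unitalization U =
    (\<forall>x\<in>U. eventually (\<lambda>(x', y). x' = x \<longrightarrow> y \<in> U) uniformity)"

lemma uapply_linear_simps [simp]:
  "uapply 0 x = 0" "uapply (S + T) x = uapply S x + uapply T x"
  "uapply (- T) x = - uapply T x" "uapply (S - T) x = uapply S x - uapply T x"
  "uapply (c *\<^sub>C T) x = c *\<^sub>C uapply T x" "uapply (r *\<^sub>R T) x = r *\<^sub>R uapply T x"
  unfolding minus_unitalization_def scaleR_unitalization_def scaleC_of_real[symmetric]
  by (transfer, simp)+

instance
proof
  fix S T U :: "'a unitalization" and c d :: complex and r s :: real
  show "S + T + U = S + (T + U)" "S + T = T + S" "0 + S = S" "- S + S = 0" "S - T = S + - T"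
    "r *\<^sub>R (S + T) = r *\<^sub>R S + r *\<^sub>R T" "(r + s) *\<^sub>R S = r *\<^sub>R S + s *\<^sub>R S"
    "r *\<^sub>R s *\<^sub>R S = (r * s) *\<^sub>R S" "1 *\<^sub>R S = S"
    "c *\<^sub>C (S + T) = c *\<^sub>C S + c *\<^sub>C T" "(c + d) *\<^sub>C S = c *\<^sub>C S + d *\<^sub>C S"
    "c *\<^sub>C d *\<^sub>C S = (c * d) *\<^sub>C S" "complex_of_real r *\<^sub>C S = r *\<^sub>R S"
    by (rule unitalization_eqI; simp add: algebra_simps scaleC_add_left scaleC_add_right
        scaleC_of_real)+
  show "sgn S = scaleR (inverse (norm S)) S" "dist S T = norm (S - T)"
    by (simp_all add: sgn_unitalization_def dist_unitalization_def)
  show "uniformity = (INF e\<in>{0 <..}. principal {(x::'a unitalization, y). dist x y < e})"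
    by (rule uniformity_unitalization_def)
  show "open V = (\<forall>x\<in>V. \<forall>\<^sub>F (x', y) in uniformity. x' = x \<longrightarrow> y \<in> V)"
    for V :: "'a unitalization set"
    by (rule open_unitalization_def)
  show "norm S = 0 \<longleftrightarrow> S = 0"
    unfolding norm_unitalization_def onorm_eq_0[OF bounded_linear_uapply]
    by (auto intro: unitalization_eqI)
  show "norm (S + T) \<le> norm S + norm T"
    unfolding norm_unitalization_def
    using onorm_triangle[OF bounded_linear_uapply[of S] bounded_linear_uapply[of T]]
    by (simp add: fun_eq_iff[symmetric, of "uapply (S + T)"] cong: if_cong
        flip: uapply_linear_simps(2))
  show nC: "norm (c *\<^sub>C S) = cmod c * norm S" for c and S :: "'a unitalization"
  proof (rule antisym)
    have le: "norm (c *\<^sub>C S) \<le> cmod c * norm S" for c and S :: "'a unitalization"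
      unfolding norm_unitalization_def
    proof (rule onorm_bound)
      fix x
      show "norm (uapply (c *\<^sub>C S) x) \<le> cmod c * onorm (uapply S) * norm x"
        using mult_left_mono[OF onorm[OF bounded_linear_uapply[of S], of x], of "cmod c"]
        by (simp add: mult.assoc)
    qed (simp add: onorm_pos_le bounded_linear_uapply)
    show "norm (c *\<^sub>C S) \<le> cmod c * norm S" by (rule le)
    show "cmod c * norm S \<le> norm (c *\<^sub>C S)"
    proof (cases "c = 0")
      case True
      then show ?thesis
        by (simp add: norm_unitalization_def onorm_pos_le bounded_linear_uapply)
    next
      case False
      have "S = inverse c *\<^sub>C c *\<^sub>C S" using False by (intro unitalization_eqI) simp
      then have "norm S \<le> inverse (cmod c) * norm (c *\<^sub>C S)"
        using le[of "inverse c" "c *\<^sub>C S"] by (simp add: norm_inverse)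
      then show ?thesis using False by (simp add: field_simps)
    qed
  qed
  show "norm (r *\<^sub>R S) = \<bar>r\<bar> * norm S"
    unfolding scaleR_unitalization_def using nC[of "complex_of_real r" S] by simp
qed

end

lemma norm_uapply: "norm (uapply T x) \<le> norm T * norm x"
  unfolding norm_unitalization_def by (rule onorm[OF bounded_linear_uapply])

lemma norm_unitalization_le:
  "0 \<le> K \<Longrightarrow> (\<And>x. norm (uapply T x) \<le> K * norm x) \<Longrightarrow> norm T \<le> K"
  unfolding norm_unitalization_def by (rule onorm_bound)

lemma norm_of_alg [simp]: "norm (of_alg a) = norm a"
proof (rule antisym)
  show "norm (of_alg a) \<le> norm a"
    by (rule norm_unitalization_le) (simp_all add: norm_mult_ineq)
  have "norm a * norm a \<le> norm (of_alg a) * norm a"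
    using norm_uapply[of "of_alg a" "star a"] cstar_identity[of "star a"]
    by (simp add: power2_eq_square)
  then show "norm a \<le> norm (of_alg a)" by (cases "a = 0") auto
qed

lemma of_alg_add: "of_alg (a + b) = of_alg a + of_alg b"
  and of_alg_diff: "of_alg (a - b) = of_alg a - of_alg b"
  and of_alg_scaleC: "of_alg (c *\<^sub>C a) = c *\<^sub>C of_alg a"
  by (rule unitalization_eqI; simp add: algebra_simps)+

instantiation unitalization :: (cstar_algebra) "{one, times, star}"
begin

lift_definition one_unitalization :: "'a unitalization" is "\<lambda>x. x"
  by (rule exI[of _ 0], rule exI[of _ 1]) simp
lift_definition times_unitalization :: "'a unitalization \<Rightarrow> 'a unitalization \<Rightarrow> 'a unitalization"
  is "\<lambda>S T x. S (T x)"
proof (elim exE, goal_cases)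
  case (1 S T a b c d)
  then show ?case
    by (intro exI[of _ "a * b + d *\<^sub>C a + c *\<^sub>C b"] exI[of _ "c * d"])
       (simp add: algebra_simps scaleC_add_right)
qed

text \<open>The adjoint of an operator with respect to the $\mathcal A$-valued inner product
  $\langle x, y\rangle = x^*y$, i.e. $(x \mapsto ax + cx)^* = (x \mapsto a^*x + \bar c x)$.\<close>

definition star_unitalization :: "'a unitalization \<Rightarrow> 'a unitalization"
  where "star_unitalization T = (THE S. \<forall>x y. star (uapply T x) * y = star x * uapply S y)"

instance ..

end

lemma uapply_mult [simp]: "uapply (S * T) x = uapply S (uapply T x)"
  and uapply_one [simp]: "uapply 1 x = x"
  by (transfer, simp)+

lemma star_of_alg_scalar [simp]:
  "star (of_alg_scalar a c :: 'a::cstar_algebra unitalization) = of_alg_scalar (star a) (cnj c)"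
  unfolding star_unitalization_def
proof (rule the_equality)
  show *: "\<forall>x y. star (uapply (of_alg_scalar a c) x) * y
      = star x * uapply (of_alg_scalar (star a) (cnj c)) y"
    by (simp add: algebra_simps)
  fix S
  assume **: "\<forall>x y. star (uapply (of_alg_scalar a c) x) * y = star x * uapply S y"
  show "S = of_alg_scalar (star a) (cnj c)"
  proof (rule unitalization_eqI)
    fix y
    let ?d = "uapply S y - uapply (of_alg_scalar (star a) (cnj c)) y"
    have "star ?d * uapply S y = star ?d * uapply (of_alg_scalar (star a) (cnj c)) y"
      using * ** by metis
    then have "star ?d * ?d = 0" by (simp only: right_diff_distrib) simp
    then show "uapply S y = uapply (of_alg_scalar (star a) (cnj c)) y"
      by (simp only: star_mult_self_eq_0) simp
  qed
qed

lemma star_uapply: "star (uapply T x) * y = star x * uapply (star T) y"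
  by (cases T) (simp add: algebra_simps)

lemma adjoint_eqI:
  fixes T :: "'a::cstar_algebra unitalization"
  assumes "\<And>x y. star (uapply T x) * y = star x * uapply S y"
  shows "star T = S"
proof (rule unitalization_eqI)
  fix y
  let ?d = "uapply (star T) y - uapply S y"
  have "star ?d * uapply (star T) y = star ?d * uapply S y"
    using assms star_uapply by metis
  then have "star ?d * ?d = 0" by (simp only: right_diff_distrib) simp
  then show "uapply (star T) y = uapply S y"
    by (simp only: star_mult_self_eq_0) simp
qed

lemma uapply_scaleC [simp]: "uapply (T :: 'a::cstar_algebra unitalization) (c *\<^sub>C x) = c *\<^sub>C uapply T x"
  by (cases T) (simp add: scaleC_add_right mult.commute)

lemma Cauchy_unitalization:
  fixes X :: "nat \<Rightarrow> 'a::cstar_algebra unitalization"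
  assumes X: "Cauchy X"
  shows "convergent X"
proof -
  have isom: "dist (of_alg a) (of_alg b) = dist a b" for a b :: 'a
    by (simp add: dist_norm flip: of_alg_diff)
  have complete_alg: "\<exists>a. (\<lambda>n. of_alg (f n)) \<longlonglongrightarrow> of_alg a"
    if "Cauchy (\<lambda>n. of_alg (f n))" for f :: "nat \<Rightarrow> 'a"
  proof -
    have "Cauchy f" using that unfolding Cauchy_def isom .
    then obtain a where "f \<longlonglongrightarrow> a"
      using Cauchy_convergent convergent_def by blast
    then have "(\<lambda>n. of_alg (f n)) \<longlonglongrightarrow> of_alg a"
      unfolding tendsto_iff isom .
    then show ?thesis by blast
  qed
  have dec: "of_alg_scalar a c = of_alg a + c *\<^sub>C (1::'a unitalization)" for a c
    by (rule unitalization_eqI) simp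
  have "\<forall>n. \<exists>a c. X n = of_alg a + c *\<^sub>C 1"
    using dec by (metis unitalization_cases)
  then obtain a c where Xn: "\<And>n. X n = of_alg (a n) + c n *\<^sub>C 1"
    by metis
  show ?thesis
  proof (cases "\<exists>e::'a. of_alg e = 1")
    case True
    then obtain e :: 'a where e: "of_alg e = 1" by blast
    have "X n = of_alg (a n + c n *\<^sub>C e)" for n
      by (simp add: Xn of_alg_add of_alg_scaleC e)
    then have "X = (\<lambda>n. of_alg (a n + c n *\<^sub>C e))" by auto
    then show ?thesis using complete_alg X convergent_def by metis
  next
    case False
    have "\<exists>d>0. \<forall>b::'a. d \<le> norm (of_alg b + 1)"
    proof (rule ccontr)
      assume "\<not> ?thesis"
      then have "\<forall>n. \<exists>b::'a. norm (of_alg b + 1) < inverse (real (Suc n))"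
        by (metis inverse_positive_iff_positive not_le of_nat_0_less_iff zero_less_Suc)
      then obtain b :: "nat \<Rightarrow> 'a"
        where b: "\<And>n. norm (of_alg (b n) + 1) < inverse (real (Suc n))" by metis
      have "(\<lambda>n. of_alg (b n) + 1) \<longlonglongrightarrow> 0"
        by (rule Lim_null_comparison[OF _ LIMSEQ_inverse_real_of_nat])
           (use b less_imp_le in \<open>auto intro!: always_eventually\<close>)
      then have lim: "(\<lambda>n. of_alg (b n)) \<longlonglongrightarrow> - 1"
        using tendsto_diff[OF _ tendsto_const[of 1], of "\<lambda>n. of_alg (b n) + 1" 0] by simp
      then obtain e where "(\<lambda>n. of_alg (b n)) \<longlonglongrightarrow> of_alg e"
        using complete_alg LIMSEQ_imp_Cauchy by blast
      then have "of_alg e = - 1" using lim LIMSEQ_unique by blast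
      then have "of_alg (- e) = 1"
        using of_alg_diff[of 0 e] of_alg_add[of 0 "0::'a"] by simp
      then show False using False by blast
    qed
    then obtain d where d: "d > 0" and db: "\<And>b::'a. d \<le> norm (of_alg b + 1)" by blast
    have bound: "cmod k * d \<le> norm (of_alg b + k *\<^sub>C 1)" for b :: 'a and k
    proof (cases "k = 0")
      case False
      have "of_alg b + k *\<^sub>C 1 = k *\<^sub>C (of_alg (inverse k *\<^sub>C b) + 1)"
        using False by (simp add: of_alg_scaleC scaleC_add_right)
      then show ?thesis using db[of "inverse k *\<^sub>C b"] by (simp add: mult_left_mono)
    qed auto
    have diff: "X m - X n = of_alg (a m - a n) + (c m - c n) *\<^sub>C 1" for m n
      by (simp add: Xn of_alg_diff scaleC_diff_left)
    have "Cauchy c"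
    proof (rule CauchyI)
      fix e :: real assume "e > 0"
      then obtain M where "\<forall>m\<ge>M. \<forall>n\<ge>M. norm (X m - X n) < e * d"
        using CauchyD[OF X, of "e * d"] d by auto
      then have "cmod (c m - c n) * d < e * d" if "m \<ge> M" "n \<ge> M" for m n
        using bound[of "c m - c n" "a m - a n"] that diff[of m n] by fastforce
      then show "\<exists>M. \<forall>m\<ge>M. \<forall>n\<ge>M. norm (c m - c n) < e"
        using d by (meson mult_less_cancel_right_pos)
    qed
    then obtain k where k: "c \<longlonglongrightarrow> k"
      using Cauchy_convergent convergent_def by blast
    have k1: "(\<lambda>n. c n *\<^sub>C (1::'a unitalization)) \<longlonglongrightarrow> k *\<^sub>C 1"
    proof (rule metric_tendsto_imp_tendsto)
      show "(\<lambda>n. c n * of_real (norm (1::'a unitalization)))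
          \<longlonglongrightarrow> k * of_real (norm (1::'a unitalization))"
        by (intro tendsto_intros k)
    qed (simp add: dist_norm norm_mult flip: scaleC_diff_left left_diff_distrib)
    have "Cauchy (\<lambda>n. of_alg (a n))"
    proof (rule CauchyI)
      fix e :: real assume "e > 0"
      then obtain M where M: "\<forall>m\<ge>M. \<forall>n\<ge>M. norm (X m - X n) < e / 2"
        using CauchyD[OF X, of "e / 2"] by auto
      obtain N where
        N: "\<forall>m\<ge>N. \<forall>n\<ge>N. norm (c m *\<^sub>C (1::'a unitalization) - c n *\<^sub>C 1) < e / 2"
        using CauchyD[OF LIMSEQ_imp_Cauchy[OF k1], of "e / 2"] \<open>e > 0\<close> by auto
      have "norm (of_alg (a m) - of_alg (a n)) < e" if "m \<ge> max M N" "n \<ge> max M N" for m n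
      proof -
        have "of_alg (a m) - of_alg (a n) = (X m - X n) - (c m *\<^sub>C 1 - c n *\<^sub>C 1)"
          by (simp add: Xn)
        then have "norm (of_alg (a m) - of_alg (a n))
            \<le> norm (X m - X n) + norm (c m *\<^sub>C (1::'a unitalization) - c n *\<^sub>C 1)"
          using norm_triangle_ineq4 by metis
        also have "\<dots> < e / 2 + e / 2" using M N that by (intro add_strict_mono) auto
        finally show ?thesis by simp
      qed
      then show "\<exists>M. \<forall>m\<ge>M. \<forall>n\<ge>M. norm (of_alg (a m) - of_alg (a n)) < e" by blast
    qed
    then obtain b where "(\<lambda>n. of_alg (a n)) \<longlonglongrightarrow> of_alg b"
      using complete_alg by blast
    then have "(\<lambda>n. of_alg (a n) + c n *\<^sub>C 1) \<longlonglongrightarrow> of_alg b + k *\<^sub>C 1"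
      by (intro tendsto_add k1)
    moreover have "X = (\<lambda>n. of_alg (a n) + c n *\<^sub>C 1)" using Xn by auto
    ultimately show ?thesis by (auto simp: convergent_def)
  qed
qed

instance unitalization :: (cstar_algebra) unital_cstar_algebra
proof
  fix S T U :: "'a unitalization" and c :: complex and r :: real
  show "S * T * U = S * (T * U)" "(S + T) * U = S * U + T * U" "1 * S = S" "S * 1 = S"
    "(r *\<^sub>R S) * T = r *\<^sub>R (S * T)" "(c *\<^sub>C S) * T = c *\<^sub>C (S * T)"
    "S * (c *\<^sub>C T) = c *\<^sub>C (S * T)"
    by (rule unitalization_eqI; simp)+
  show "S * (T + U) = S * T + S * U"
    by (rule unitalization_eqI) (simp add: uapply_add)
  show "S * (r *\<^sub>R T) = r *\<^sub>R (S * T)"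
    by (rule unitalization_eqI)
       (simp add: linear_scale[OF bounded_linear.linear[OF bounded_linear_uapply]])
  show "norm (S * T) \<le> norm S * norm T"
    unfolding norm_unitalization_def
    using onorm_compose[OF bounded_linear_uapply[of S] bounded_linear_uapply[of T]]
    by (simp add: comp_def flip: uapply_mult)
  show "star (S + T) = star S + star T" "star (c *\<^sub>C S) = cnj c *\<^sub>C star S"
    "star (S * T) = star T * star S"
    by (rule adjoint_eqI; simp add: star_uapply distrib_right distrib_left)+
  show "star (star S) = S" by (cases S) simp
  show "convergent X" if "Cauchy X" for X :: "nat \<Rightarrow> 'a unitalization"
    using that by (rule Cauchy_unitalization)
  show "norm (star S * S) = (norm S)\<^sup>2"
  proof (rule antisym)
    have ge: "(norm V)\<^sup>2 \<le> norm (star V * V)" for V :: "'a unitalization"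
    proof -
      have "norm V \<le> sqrt (norm (star V * V))"
      proof (rule norm_unitalization_le)
        fix x
        have "(norm (uapply V x))\<^sup>2 = norm (star x * uapply (star V * V) x)"
          by (simp add: cstar_identity[symmetric] star_uapply)
        also have "\<dots> \<le> norm (star x) * norm (uapply (star V * V) x)" by (rule norm_mult_ineq)
        also have "\<dots> \<le> norm x * (norm (star V * V) * norm x)"
          using norm_uapply[of "star V * V" x] by (simp add: mult_left_mono)
        also have "\<dots> = (sqrt (norm (star V * V)) * norm x)\<^sup>2"
          by (simp add: power_mult_distrib power2_eq_square)
        finally show "norm (uapply V x) \<le> sqrt (norm (star V * V)) * norm x"
          by (rule power2_le_imp_le) simp
      qed simp
      then show ?thesis using real_le_rsqrt[of "norm V"] by (metis norm_ge_zero
            real_sqrt_le_iff real_sqrt_unique power2_eq_square real_sqrt_mult_self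
            power_mono abs_of_nonneg)
    qed
    have sub: "norm (V * W) \<le> norm V * norm W" for V W :: "'a unitalization"
      unfolding norm_unitalization_def
      using onorm_compose[OF bounded_linear_uapply[of V] bounded_linear_uapply[of W]]
      by (simp add: comp_def flip: uapply_mult)
    have le: "norm V \<le> norm (star V)" for V :: "'a unitalization"
    proof (cases "V = 0")
      case False
      have "norm V * norm V \<le> norm (star V) * norm V"
        using ge[of V] sub[of "star V" V] by (simp add: power2_eq_square)
      then show ?thesis using False by simp
    qed simp
    show "(norm S)\<^sup>2 \<le> norm (star S * S)" by (rule ge)
    have "star (star S) = S" by (cases S) simp
    then have "norm (star S) \<le> norm S" using le[of "star S"] by simp
    then show "norm (star S * S) \<le> (norm S)\<^sup>2"
      using sub[of "star S" S] by (metis mult_right_mono norm_ge_zero order_trans power2_eq_square)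
  qed
qed

lemma of_alg_scalar_eq_iff:
  fixes a b :: "'a::cstar_algebra"
  assumes "\<not> unital TYPE('a)"
  shows "of_alg_scalar a c = of_alg_scalar b d \<longleftrightarrow> a = b \<and> c = d"
proof
  assume "of_alg_scalar a c = of_alg_scalar b d"
  then have "uapply (of_alg_scalar a c) x = uapply (of_alg_scalar b d) x" for x by simp
  then have eq: "(a - b) * x = (d - c) *\<^sub>C x" for x
    by (simp add: left_diff_distrib scaleC_diff_left algebra_simps)
  have "c = d"
  proof (rule ccontr)
    assume "c \<noteq> d"
    define e where "e = inverse (d - c) *\<^sub>C (a - b)"
    have l: "e * x = x" for x
      using eq[of x] \<open>c \<noteq> d\<close> by (simp add: e_def)
    have r: "x * star e = x" for x
      using arg_cong[OF l[of "star x"], of star] by simp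
    have "star e = e" using l[of "star e"] r[of e] by simp
    then have "unital TYPE('a)" using l r unfolding unital_def by metis
    then show False using assms by simp
  qed
  moreover have "(norm (a - b))\<^sup>2 = 0"
    using eq[of "star (a - b)"] \<open>c = d\<close> cstar_identity[of "star (a - b)"]
      norm_star[of "a - b"] by (simp del: star_diff norm_star)
  ultimately show "a = b \<and> c = d" by simp
qed simp

lemma surj_of_alg:
  assumes "unital TYPE('a::cstar_algebra)"
  shows "surj (of_alg :: 'a \<Rightarrow> 'a unitalization)"
proof -
  obtain e :: 'a where e: "\<And>x. e * x = x" using assms unfolding unital_def by blast
  have "of_alg (uapply T e) = T" for T
    by (rule unitalization_eqI, cases T)
       (simp add: e distrib_right mult.assoc)
  then show ?thesis by (rule surjI)
qed

lemma of_alg_mult: "of_alg (a * b) = of_alg a * of_alg b"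
  by (rule unitalization_eqI) (simp add: mult.assoc)

lemma of_alg_star: "of_alg (star a) = star (of_alg a)"
  by (simp add: of_alg_def)


section \<open>The universal enveloping von Neumann algebra\<close>

text \<open>It is realised as the bidual, with the (first) Arens product and the involution extending
  that of the algebra.  Its ultraweak topology is then the weak-star topology, i.e. that of
  pointwise convergence on the dual.\<close>

typedef (overloaded) 'a dual =
  "{f :: 'a::complex_normed_vector \<Rightarrow> complex. bounded_linear f \<and> (\<forall>c x. f (c *\<^sub>C x) = c * f x)}"
  morphisms dapply Dual
  by (rule exI[of _ "\<lambda>_. 0"]) simp

lemma bounded_linear_dapply: "bounded_linear (dapply \<phi>)"
  using dapply[of \<phi>] by simp

lemma dapply_scaleC [simp]: "dapply \<phi> (c *\<^sub>C x) = c * dapply \<phi> x"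
  using dapply[of \<phi>] by simp

lemma dapply_simps [simp]:
  "dapply \<phi> 0 = 0" "dapply \<phi> (x + y) = dapply \<phi> x + dapply \<phi> y"
  "dapply \<phi> (- x) = - dapply \<phi> x" "dapply \<phi> (x - y) = dapply \<phi> x - dapply \<phi> y"
  "dapply \<phi> (r *\<^sub>R x) = of_real r * dapply \<phi> x"
  using linear_0 linear_add linear_neg linear_diff linear_scale
    bounded_linear.linear[OF bounded_linear_dapply[of \<phi>]]
  by (blast, blast, blast, blast, metis scaleR_conv_of_real)

lemma dual_eqI: "(\<And>x. dapply \<phi> x = dapply \<psi> x) \<Longrightarrow> \<phi> = \<psi>"
  by (metis dapply_inject ext)

lemma Dual_apply:
  assumes "\<And>x y. f (x + y) = f x + f y" "\<And>c x. f (c *\<^sub>C x) = c * f x"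
    and "\<And>x. cmod (f x) \<le> K * norm x"
  shows "dapply (Dual f) x = f x"
proof -
  have "bounded_linear f"
  proof (rule bounded_linear_intro[where K = K])
    show "f (r *\<^sub>R y) = r *\<^sub>R f y" for r y
      using assms(2)[of "of_real r" y] by (simp add: scaleC_of_real scaleR_conv_of_real)
    show "norm (f y) \<le> norm y * K" for y using assms(3)[of y] by (simp add: mult.commute)
  qed (rule assms(1))
  then show ?thesis using assms(2) by (simp add: Dual_inverse)
qed

instantiation dual :: (complex_normed_vector) complex_normed_vector
begin

definition zero_dual :: "'a dual" where "0 = Dual (\<lambda>x::'a. 0)"
definition plus_dual :: "'a dual \<Rightarrow> 'a dual \<Rightarrow> 'a dual"
  where "\<phi> + \<psi> = Dual (\<lambda>x::'a. dapply \<phi> x + dapply \<psi> x)"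
definition uminus_dual :: "'a dual \<Rightarrow> 'a dual"
  where "- \<phi> = Dual (\<lambda>x::'a. - dapply \<phi> x)"
definition minus_dual :: "'a dual \<Rightarrow> 'a dual \<Rightarrow> 'a dual"
  where "\<phi> - \<psi> = Dual (\<lambda>x::'a. dapply \<phi> x - dapply \<psi> x)"
definition scaleC_dual :: "complex \<Rightarrow> 'a dual \<Rightarrow> 'a dual"
  where "c *\<^sub>C \<phi> = Dual (\<lambda>x::'a. c * dapply \<phi> x)"
definition scaleR_dual :: "real \<Rightarrow> 'a dual \<Rightarrow> 'a dual"
  where "r *\<^sub>R \<phi> = complex_of_real r *\<^sub>C (\<phi> :: 'a dual)"
definition norm_dual :: "'a dual \<Rightarrow> real"
  where "norm_dual \<phi> = onorm (dapply \<phi>)"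
definition sgn_dual :: "'a dual \<Rightarrow> 'a dual"
  where "sgn_dual \<phi> = scaleR (inverse (norm \<phi>)) \<phi>"
definition dist_dual :: "'a dual \<Rightarrow> 'a dual \<Rightarrow> real"
  where "dist_dual \<phi> \<psi> = norm (\<phi> - \<psi>)"
definition uniformity_dual :: "('a dual \<times> 'a dual) filter"
  where "uniformity_dual = (INF e\<in>{0 <..}. principal {(x, y). dist x y < e})"
definition open_dual :: "'a dual set \<Rightarrow> bool"
  where "open_dual U = (\<forall>x\<in>U. eventually (\<lambda>(x', y). x' = x \<longrightarrow> y \<in> U) uniformity)"

lemma dapply_bound: "cmod (dapply \<phi> x) \<le> norm \<phi> * norm x"
  unfolding norm_dual_def by (rule onorm[OF bounded_linear_dapply])

lemma norm_dual_le:
  "0 \<le> K \<Longrightarrow> (\<And>x. cmod (dapply \<phi> x) \<le> K * norm x) \<Longrightarrow> norm \<phi> \<le> K"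
  unfolding norm_dual_def by (rule onorm_bound)

lemma dapply_linear_simps [simp]:
  "dapply 0 x = 0" "dapply (\<phi> + \<psi>) x = dapply \<phi> x + dapply \<psi> x"
  "dapply (- \<phi>) x = - dapply \<phi> x" "dapply (\<phi> - \<psi>) x = dapply \<phi> x - dapply \<psi> x"
  "dapply (c *\<^sub>C \<phi>) x = c * dapply \<phi> x" "dapply (r *\<^sub>R \<phi>) x = of_real r * dapply \<phi> x"
proof -
  note bl = bounded_linear_dapply
  show "dapply 0 x = 0"
    unfolding zero_dual_def by (rule Dual_apply[where K = 0]) simp_all
  show "dapply (\<phi> + \<psi>) x = dapply \<phi> x + dapply \<psi> x"
    unfolding plus_dual_def using bounded_linear_add[OF bl[of \<phi>] bl[of \<psi>]]
    by (simp add: Dual_inverse algebra_simps)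
  show "dapply (- \<phi>) x = - dapply \<phi> x"
    unfolding uminus_dual_def using bounded_linear_minus[OF bl[of \<phi>]]
    by (simp add: Dual_inverse)
  show "dapply (\<phi> - \<psi>) x = dapply \<phi> x - dapply \<psi> x"
    unfolding minus_dual_def using bounded_linear_sub[OF bl[of \<phi>] bl[of \<psi>]]
    by (simp add: Dual_inverse algebra_simps)
  show C: "dapply (c *\<^sub>C \<phi>) x = c * dapply \<phi> x" for c
    unfolding scaleC_dual_def using bounded_linear_const_mult[OF bl[of \<phi>]]
    by (simp add: Dual_inverse algebra_simps)
  show "dapply (r *\<^sub>R \<phi>) x = of_real r * dapply \<phi> x"
    unfolding scaleR_dual_def by (rule C)
qed

instance
proof
  fix \<phi> \<psi> \<rho> :: "'a dual" and c d :: complex and r s :: real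
  show "\<phi> + \<psi> + \<rho> = \<phi> + (\<psi> + \<rho>)" "\<phi> + \<psi> = \<psi> + \<phi>" "0 + \<phi> = \<phi>" "- \<phi> + \<phi> = 0" "\<phi> - \<psi> = \<phi> + - \<psi>"
    "r *\<^sub>R (\<phi> + \<psi>) = r *\<^sub>R \<phi> + r *\<^sub>R \<psi>" "(r + s) *\<^sub>R \<phi> = r *\<^sub>R \<phi> + s *\<^sub>R \<phi>"
    "r *\<^sub>R s *\<^sub>R \<phi> = (r * s) *\<^sub>R \<phi>" "1 *\<^sub>R \<phi> = \<phi>"
    "c *\<^sub>C (\<phi> + \<psi>) = c *\<^sub>C \<phi> + c *\<^sub>C \<psi>" "(c + d) *\<^sub>C \<phi> = c *\<^sub>C \<phi> + d *\<^sub>C \<phi>"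
    "c *\<^sub>C d *\<^sub>C \<phi> = (c * d) *\<^sub>C \<phi>" "complex_of_real r *\<^sub>C \<phi> = r *\<^sub>R \<phi>"
    by (rule dual_eqI; simp add: algebra_simps)+
  show "sgn \<phi> = scaleR (inverse (norm \<phi>)) \<phi>" "dist \<phi> \<psi> = norm (\<phi> - \<psi>)"
    by (simp_all add: sgn_dual_def dist_dual_def)
  show "uniformity = (INF e\<in>{0 <..}. principal {(x::'a dual, y). dist x y < e})"
    by (rule uniformity_dual_def)
  show "open V = (\<forall>x\<in>V. \<forall>\<^sub>F (x', y) in uniformity. x' = x \<longrightarrow> y \<in> V)" for V :: "'a dual set"
    by (rule open_dual_def)
  show "norm \<phi> = 0 \<longleftrightarrow> \<phi> = 0"
    unfolding norm_dual_def onorm_eq_0[OF bounded_linear_dapply] by (auto intro: dual_eqI)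
  have pos: "0 \<le> norm \<phi>" for \<phi> :: "'a dual"
    by (simp add: norm_dual_def onorm_pos_le bounded_linear_dapply)
  show "norm (\<phi> + \<psi>) \<le> norm \<phi> + norm \<psi>"
  proof (rule norm_dual_le)
    fix x
    show "cmod (dapply (\<phi> + \<psi>) x) \<le> (norm \<phi> + norm \<psi>) * norm x"
      using norm_triangle_ineq[of "dapply \<phi> x" "dapply \<psi> x"] dapply_bound[of \<phi> x]
        dapply_bound[of \<psi> x] by (simp add: distrib_right)
  qed (simp add: pos)
  show nC: "norm (c *\<^sub>C \<phi>) = cmod c * norm \<phi>" for c and \<phi> :: "'a dual"
  proof (rule antisym)
    have le: "norm (c *\<^sub>C \<phi>) \<le> cmod c * norm \<phi>" for c and \<phi> :: "'a dual"
    proof (rule norm_dual_le)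
      fix x
      show "cmod (dapply (c *\<^sub>C \<phi>) x) \<le> cmod c * norm \<phi> * norm x"
        using mult_left_mono[OF dapply_bound[of \<phi> x], of "cmod c"]
        by (simp add: norm_mult mult.assoc)
    qed (simp add: pos)
    show "norm (c *\<^sub>C \<phi>) \<le> cmod c * norm \<phi>" by (rule le)
    show "cmod c * norm \<phi> \<le> norm (c *\<^sub>C \<phi>)"
    proof (cases "c = 0")
      case True
      then show ?thesis by (simp add: pos)
    next
      case False
      have "\<phi> = inverse c *\<^sub>C c *\<^sub>C \<phi>" using False by (intro dual_eqI) simp
      then have "norm \<phi> \<le> inverse (cmod c) * norm (c *\<^sub>C \<phi>)"
        using le[of "inverse c" "c *\<^sub>C \<phi>"] by (simp add: norm_inverse)
      then show ?thesis using False by (simp add: field_simps)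
    qed
  qed
  show "norm (r *\<^sub>R \<phi>) = \<bar>r\<bar> * norm \<phi>"
    unfolding scaleR_dual_def using nC[of "complex_of_real r" \<phi>] by simp
qed

end

type_synonym 'a enveloping = "'a dual dual"

definition canon :: "'a::complex_normed_vector \<Rightarrow> 'a enveloping" where
  "canon a = Dual (\<lambda>\<phi>. dapply \<phi> a)"

definition ultraweak_topology :: "'a::complex_normed_vector enveloping topology" where
  "ultraweak_topology = pullback_topology UNIV dapply euclidean"

definition dual_shift :: "'a::cstar_algebra dual \<Rightarrow> 'a \<Rightarrow> 'a dual" where
  "dual_shift \<phi> a = Dual (\<lambda>b. dapply \<phi> (a * b))"

definition arens_act :: "'a::cstar_algebra enveloping \<Rightarrow> 'a dual \<Rightarrow> 'a dual" where
  "arens_act G \<phi> = Dual (\<lambda>a. dapply G (dual_shift \<phi> a))"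

definition arens_mult :: "'a::cstar_algebra enveloping \<Rightarrow> 'a enveloping \<Rightarrow> 'a enveloping" where
  "arens_mult F G = Dual (\<lambda>\<phi>. dapply F (arens_act G \<phi>))"

definition dual_star :: "'a::cstar_algebra dual \<Rightarrow> 'a dual" where
  "dual_star \<phi> = Dual (\<lambda>a. cnj (dapply \<phi> (star a)))"

definition enveloping_star :: "'a::cstar_algebra enveloping \<Rightarrow> 'a enveloping" where
  "enveloping_star F = Dual (\<lambda>\<phi>. cnj (dapply F (dual_star \<phi>)))"

definition enveloping_le :: "'a::cstar_algebra enveloping \<Rightarrow> 'a enveloping \<Rightarrow> bool"
    (infix \<open>\<le>\<^sub>*\<^sub>*\<close> 50) where
  "F \<le>\<^sub>*\<^sub>* G \<longleftrightarrow> (\<exists>H. G - F = arens_mult (enveloping_star H) H)"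

lemma dapply_canon [simp]: "dapply (canon a) \<phi> = dapply \<phi> a"
  unfolding canon_def
  by (rule Dual_apply[where K = "norm a"])
     (use dapply_bound in \<open>auto simp: mult.commute\<close>)

lemma dapply_dual_shift [simp]: "dapply (dual_shift \<phi> a) b = dapply \<phi> (a * b)"
  unfolding dual_shift_def
proof (rule Dual_apply[where K = "norm \<phi> * norm a"])
  fix x
  have "cmod (dapply \<phi> (a * x)) \<le> norm \<phi> * norm (a * x)" by (rule dapply_bound)
  also have "\<dots> \<le> norm \<phi> * (norm a * norm x)"
    by (intro mult_left_mono norm_mult_ineq) simp
  finally show "cmod (dapply \<phi> (a * x)) \<le> norm \<phi> * norm a * norm x" by (simp add: mult.assoc)
qed (simp_all add: distrib_left)

lemma norm_dual_shift: "norm (dual_shift \<phi> a) \<le> norm \<phi> * norm a"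
proof (rule norm_dual_le)
  fix x
  have "cmod (dapply \<phi> (a * x)) \<le> norm \<phi> * norm (a * x)" by (rule dapply_bound)
  also have "\<dots> \<le> norm \<phi> * (norm a * norm x)"
    by (intro mult_left_mono norm_mult_ineq) simp
  finally show "cmod (dapply (dual_shift \<phi> a) x) \<le> norm \<phi> * norm a * norm x"
    by (simp add: mult.assoc)
qed simp

lemma dual_shift_linear:
  "dual_shift \<phi> (a + b) = dual_shift \<phi> a + dual_shift \<phi> b"
  "dual_shift \<phi> (c *\<^sub>C a) = c *\<^sub>C dual_shift \<phi> a"
  "dual_shift (\<phi> + \<psi>) a = dual_shift \<phi> a + dual_shift \<psi> a"
  "dual_shift (c *\<^sub>C \<phi>) a = c *\<^sub>C dual_shift \<phi> a"
  by (rule dual_eqI; simp add: distrib_right)+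

lemma arens_act_bound: "cmod (dapply G (dual_shift \<phi> a)) \<le> norm G * norm \<phi> * norm a"
  using order_trans[OF dapply_bound[of G "dual_shift \<phi> a"]
      mult_left_mono[OF norm_dual_shift[of \<phi> a], of "norm G"]]
  by (simp add: mult.assoc)

lemma dapply_arens_act [simp]: "dapply (arens_act G \<phi>) a = dapply G (dual_shift \<phi> a)"
  unfolding arens_act_def
  by (rule Dual_apply[where K = "norm G * norm \<phi>"])
     (simp_all add: dual_shift_linear arens_act_bound)

lemma dapply_arens_mult [simp]: "dapply (arens_mult F G) \<phi> = dapply F (arens_act G \<phi>)"
  unfolding arens_mult_def
proof (rule Dual_apply[where K = "norm F * norm G"])
  show "dapply F (arens_act G (\<phi> + \<psi>)) = dapply F (arens_act G \<phi>) + dapply F (arens_act G \<psi>)"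
    for \<phi> \<psi>
  proof -
    have "arens_act G (\<phi> + \<psi>) = arens_act G \<phi> + arens_act G \<psi>"
      by (rule dual_eqI) (simp add: dual_shift_linear)
    then show ?thesis by simp
  qed
  show "dapply F (arens_act G (c *\<^sub>C \<phi>)) = c * dapply F (arens_act G \<phi>)" for c \<phi>
  proof -
    have "arens_act G (c *\<^sub>C \<phi>) = c *\<^sub>C arens_act G \<phi>"
      by (rule dual_eqI) (simp add: dual_shift_linear)
    then show ?thesis by simp
  qed
  show "cmod (dapply F (arens_act G \<phi>)) \<le> norm F * norm G * norm \<phi>" for \<phi>
  proof -
    have "norm (arens_act G \<phi>) \<le> norm G * norm \<phi>"
      by (rule norm_dual_le) (simp_all add: arens_act_bound)
    then show ?thesis
      using order_trans[OF dapply_bound[of F "arens_act G \<phi>"]] mult_left_mono[of _ _ "norm F"]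
      by (simp add: mult.assoc)
  qed
qed

lemma dual_star_bound: "cmod (cnj (dapply \<phi> (star (a::'a::cstar_algebra)))) \<le> norm \<phi> * norm a"
  using dapply_bound[of \<phi> "star a"] by simp

lemma dapply_dual_star [simp]: "dapply (dual_star \<phi>) a = cnj (dapply \<phi> (star a))"
  unfolding dual_star_def
  by (rule Dual_apply[where K = "norm \<phi>"]) (use dual_star_bound in simp_all)

lemma dapply_enveloping_star [simp]:
  "dapply (enveloping_star F) \<phi> = cnj (dapply F (dual_star \<phi>))"
  unfolding enveloping_star_def
proof (rule Dual_apply[where K = "norm F"])
  show "cnj (dapply F (dual_star (\<phi> + \<psi>))) = cnj (dapply F (dual_star \<phi>)) + cnj (dapply F (dual_star \<psi>))"
    for \<phi> \<psi>
  proof -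
    have "dual_star (\<phi> + \<psi>) = dual_star \<phi> + dual_star \<psi>" by (rule dual_eqI) simp
    then show ?thesis by simp
  qed
  show "cnj (dapply F (dual_star (c *\<^sub>C \<phi>))) = c * cnj (dapply F (dual_star \<phi>))" for c \<phi>
  proof -
    have "dual_star (c *\<^sub>C \<phi>) = cnj c *\<^sub>C dual_star \<phi>" by (rule dual_eqI) simp
    then show ?thesis by simp
  qed
  show "cmod (cnj (dapply F (dual_star \<phi>))) \<le> norm F * norm \<phi>" for \<phi>
  proof -
    have "norm (dual_star \<phi>) \<le> norm \<phi>"
      by (rule norm_dual_le) (use dual_star_bound in simp_all)
    then show ?thesis
      using order_trans[OF dapply_bound[of F "dual_star \<phi>"]] mult_left_mono[of _ _ "norm F"]
      by simp
  qed
qed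

lemma canon_diff: "canon (a - b) = canon a - canon b"
  by (rule dual_eqI) simp

lemma canon_scaleR: "canon (r *\<^sub>R a) = r *\<^sub>R canon a"
  by (rule dual_eqI) simp

lemma canon_mult: "canon (a * b) = arens_mult (canon a) (canon b)"
  by (rule dual_eqI) simp

lemma canon_star: "canon (star a) = enveloping_star (canon a)"
  by (rule dual_eqI) simp

lemma canon_mono: "a \<le>\<^sub>* b \<Longrightarrow> canon a \<le>\<^sub>*\<^sub>* canon b"
  unfolding cstar_le_def enveloping_le_def by (metis canon_diff canon_mult canon_star)

lemma limitin_ultraweak_iff:
  "limitin ultraweak_topology f T F \<longleftrightarrow> (\<forall>\<phi>. ((\<lambda>i. dapply (f i) \<phi>) \<longlongrightarrow> dapply T \<phi>) F)"
proof -
  have "limitin ultraweak_topology f T F \<longleftrightarrow> ((\<lambda>i. dapply (f i)) \<longlongrightarrow> dapply T) F"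
    unfolding limitin_def tendsto_def ultraweak_topology_def
    by (auto simp: openin_pullback_topology topspace_pullback_topology)
  also have "\<dots> \<longleftrightarrow> (\<forall>\<phi>. ((\<lambda>i. dapply (f i) \<phi>) \<longlongrightarrow> dapply T \<phi>) F)"
  proof
    assume L: "((\<lambda>i. dapply (f i)) \<longlongrightarrow> dapply T) F"
    show "\<forall>\<phi>. ((\<lambda>i. dapply (f i) \<phi>) \<longlongrightarrow> dapply T \<phi>) F"
    proof
      fix \<phi>
      show "((\<lambda>i. dapply (f i) \<phi>) \<longlongrightarrow> dapply T \<phi>) F"
        using continuous_on_tendsto_compose[OF continuous_on_product_coordinates[of \<phi>] L]
        by simp
    qed
  next
    assume "\<forall>\<phi>. ((\<lambda>i. dapply (f i) \<phi>) \<longlongrightarrow> dapply T \<phi>) F"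
    then have "limitin (product_topology (\<lambda>_. euclidean) UNIV) (\<lambda>i. dapply (f i)) (dapply T) F"
      by (simp add: limitin_componentwise)
    then show "((\<lambda>i. dapply (f i)) \<longlongrightarrow> dapply T) F"
      by (simp add: euclidean_product_topology)
  qed
  finally show ?thesis .
qed


section \<open>Hilbert modules and frames\<close>

text \<open>Right modules; the inner product is linear in its second argument.  Completeness with
  respect to the norm coming from the inner product is contained in the class \<open>banach\<close>.\<close>

locale hilbert_module =
  fixes act :: "'n::{complex_normed_vector, banach} \<Rightarrow> 'b::unital_cstar_algebra \<Rightarrow> 'n"
    and ip :: "'n \<Rightarrow> 'n \<Rightarrow> 'b"
  assumes act_add_left: "act (x + y) b = act x b + act y b"
    and act_add_right: "act x (b + d) = act x b + act x d"
    and act_mult: "act x (b * d) = act (act x b) d"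
    and act_one: "act x 1 = x"
    and act_scaleC_left: "act (c *\<^sub>C x) b = c *\<^sub>C act x b"
    and act_scaleC_right: "act x (c *\<^sub>C b) = c *\<^sub>C act x b"
    and ip_add: "ip x (y + z) = ip x y + ip x z"
    and ip_act: "ip x (act y b) = ip x y * b"
    and ip_star: "star (ip x y) = ip y x"
    and ip_nonneg: "0 \<le>\<^sub>* ip x x"
    and norm_ip: "(norm x)\<^sup>2 = norm (ip x x)"

text \<open>\<open>has_sum\<close> is convergence in norm of the net of finite partial sums.  Both kinds of
  frames are families \<open>xs\<close> indexed by the set \<open>J\<close>.\<close>

definition standard_frame ::
    "('n \<Rightarrow> 'n \<Rightarrow> 'b::unital_cstar_algebra) \<Rightarrow> 'j set \<Rightarrow> ('j \<Rightarrow> 'n) \<Rightarrow> bool" where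
  "standard_frame ip J xs \<longleftrightarrow> (\<exists>c1 c2 :: real. c1 > 0 \<and> c2 > 0 \<and>
     (\<forall>x. \<exists>s. ((\<lambda>j. ip x (xs j) * ip (xs j) x) has_sum s) J \<and>
        c1 *\<^sub>R ip x x \<le>\<^sub>* s \<and> s \<le>\<^sub>* c2 *\<^sub>R ip x x))"

definition nonstandard_frame ::
    "('n \<Rightarrow> 'n \<Rightarrow> 'b::unital_cstar_algebra) \<Rightarrow> 'j set \<Rightarrow> ('j \<Rightarrow> 'n) \<Rightarrow> bool" where
  "nonstandard_frame ip J xs \<longleftrightarrow> (\<exists>c1 c2 :: real. c1 > 0 \<and> c2 > 0 \<and>
     (\<forall>x. \<exists>T. limitin ultraweak_topology
          (\<lambda>F. canon (\<Sum>j\<in>F. ip x (xs j) * ip (xs j) x)) T (finite_subsets_at_top J) \<and>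
        c1 *\<^sub>R canon (ip x x) \<le>\<^sub>*\<^sub>* T \<and> T \<le>\<^sub>*\<^sub>* c2 *\<^sub>R canon (ip x x)))"

lemma standard_frame_imp_nonstandard_frame:
  assumes "standard_frame ip J xs"
  shows "nonstandard_frame ip J xs"
proof -
  obtain c1 c2 :: real where c: "c1 > 0" "c2 > 0"
    and fr: "\<And>x. \<exists>s. ((\<lambda>j. ip x (xs j) * ip (xs j) x) has_sum s) J \<and>
        c1 *\<^sub>R ip x x \<le>\<^sub>* s \<and> s \<le>\<^sub>* c2 *\<^sub>R ip x x"
    using assms unfolding standard_frame_def by blast
  show ?thesis
    unfolding nonstandard_frame_def
  proof (rule exI[of _ c1], rule exI[of _ c2], intro conjI c allI)
    fix x
    obtain s where s: "((\<lambda>j. ip x (xs j) * ip (xs j) x) has_sum s) J"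
      "c1 *\<^sub>R ip x x \<le>\<^sub>* s" "s \<le>\<^sub>* c2 *\<^sub>R ip x x" using fr by blast
    have "limitin ultraweak_topology
        (\<lambda>F. canon (\<Sum>j\<in>F. ip x (xs j) * ip (xs j) x)) (canon s) (finite_subsets_at_top J)"
      using s(1) bounded_linear.tendsto[OF bounded_linear_dapply]
      by (auto simp: limitin_ultraweak_iff has_sum_def)
    moreover have "c1 *\<^sub>R canon (ip x x) \<le>\<^sub>*\<^sub>* canon s" "canon s \<le>\<^sub>*\<^sub>* c2 *\<^sub>R canon (ip x x)"
      using s(2,3) canon_mono canon_scaleR by metis+
    ultimately show "\<exists>T. limitin ultraweak_topology
          (\<lambda>F. canon (\<Sum>j\<in>F. ip x (xs j) * ip (xs j) x)) T (finite_subsets_at_top J) \<and>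
        c1 *\<^sub>R canon (ip x x) \<le>\<^sub>*\<^sub>* T \<and> T \<le>\<^sub>*\<^sub>* c2 *\<^sub>R canon (ip x x)"
      by blast
  qed
qed

text \<open>The algebra as a Hilbert module over its unitalization.  Elements of the unitalization act
  from the left on the algebra, so its right multiplication by \<open>T\<close> is expressed through the
  involution: $a \cdot (b + c) = ((b + c)^* a^*)^* = ab + ca$.\<close>

definition self_act :: "'a::cstar_algebra \<Rightarrow> 'a unitalization \<Rightarrow> 'a" where
  "self_act a T = star (uapply (star T) (star a))"

definition self_ip :: "'a::cstar_algebra \<Rightarrow> 'a \<Rightarrow> 'a unitalization" where
  "self_ip a b = of_alg (star a * b)"

lemma of_alg_self_act: "of_alg (self_act a T) = of_alg a * T"
  by (rule unitalization_eqI, cases T)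
     (simp add: self_act_def algebra_simps scaleC_add_right)

lemma hilbert_module_self: "hilbert_module self_act self_ip"
proof
  fix x y z :: 'a and b d :: "'a unitalization" and c :: complex
  show "self_act (x + y) b = self_act x b + self_act y b"
    by (simp add: self_act_def uapply_add)
  show "self_act x (b + d) = self_act x b + self_act x d" by (simp add: self_act_def)
  show "self_act x (b * d) = self_act (self_act x b) d" by (simp add: self_act_def)
  have "star (1::'a unitalization) = 1" by (rule adjoint_eqI) simp
  then show "self_act x 1 = x" by (simp add: self_act_def)
  show "self_act (c *\<^sub>C x) b = c *\<^sub>C self_act x b" by (simp add: self_act_def)
  show "self_act x (c *\<^sub>C b) = c *\<^sub>C self_act x b" by (simp add: self_act_def)
  show "self_ip x (y + z) = self_ip x y + self_ip x z"
    by (simp add: self_ip_def distrib_left of_alg_add)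
  show "self_ip x (self_act y b) = self_ip x y * b"
    by (simp add: self_ip_def of_alg_mult of_alg_self_act mult.assoc)
  show "star (self_ip x y) = self_ip y x"
    by (simp add: self_ip_def flip: of_alg_star)
  show "0 \<le>\<^sub>* self_ip x x"
    unfolding cstar_le_def
    by (intro exI[of _ "of_alg x"]) (simp add: self_ip_def of_alg_mult of_alg_star)
  show "(norm x)\<^sup>2 = norm (self_ip x x)" by (simp add: self_ip_def cstar_identity)
qed

end

theory Submission
  imports Defs
begin

text \<open>
  For the commutative algebra of continuous functions vanishing at infinity on a locally compact
  space, the frame condition bounds \<open>\<Sum>j. \<bar>x j t\<bar>\<^sup>2\<close> away from zero and infinity, uniformly in the
  points \<open>t\<close>.  At each point, only countably many \<open>x j\<close> are nonzero.  A local unit common to countably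
  many functions exists (take one for a weighted sum of their squares) and has compact support
  without being a unit, so there always is a further point where all of them vanish.  This gives a
  sequence of points \<open>t n\<close> such that each index \<open>j\<close> is seen by at most one of them.  Again by a common
  local unit, the sequence stays in a compact set and has a cluster point.  There, all \<open>x j\<close> vanish,
  which contradicts the lower frame bound.

  In general, states take the place of points.  Lemma \<open>escaping_state\<close> produces a state that kills
  countably many given \<open>x j\<close> and sees only countably many others, \<open>countable_local_unit\<close> keeps a
  sequence of such states from running off to infinity, and \<open>cluster_functional\<close> provides the limit.
  The lower bound in the limit contradicts \<open>frame_lower_bound\<close>.  Standard frames are nonstandard ones,
  so one argument covers both.

  Two facts about positive functionals carry this.  There are enough of them
  (\<open>norming_functional\<close>): this follows from the Hahn--Banach theorem once every \<open>star b * b\<close> is known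
  to be positive (\<open>positive_star_mult\<close>), for which square roots given by power series suffice.
  And they respect the order of the enveloping algebra (\<open>enveloping_le_apply\<close>), because an element of
  the bidual acts on the Hilbert space of a positive functional by way of an approximate Riesz
  representation.
\<close>

section \<open>Linear functionals below sublinear ones\<close>

definition sublinear :: "('a::real_vector \<Rightarrow> real) \<Rightarrow> bool" where
  "sublinear p \<longleftrightarrow> (\<forall>x y. p (x + y) \<le> p x + p y) \<and> (\<forall>t\<ge>0. \<forall>x. p (t *\<^sub>R x) \<le> t * p x)"

lemma sublinear_add: "sublinear p \<Longrightarrow> p (x + y) \<le> p x + p y"
  by (simp add: sublinear_def)

lemma sublinear_scale_le: "sublinear p \<Longrightarrow> 0 \<le> t \<Longrightarrow> p (t *\<^sub>R x) \<le> t * p x"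
  by (simp add: sublinear_def)

lemma sublinear_zero: "sublinear p \<Longrightarrow> p 0 = 0"
  using sublinear_add[of p 0 0] sublinear_scale_le[of p 0 0] by simp

lemma sublinear_neg: "sublinear p \<Longrightarrow> - p (- x) \<le> p x"
  using sublinear_add[of p x "- x"] sublinear_zero[of p] by simp

lemma sublinear_scale:
  assumes "sublinear p" "0 \<le> t" shows "p (t *\<^sub>R x) = t * p x"
proof (cases "t = 0")
  case False
  then have "p x \<le> inverse t * p (t *\<^sub>R x)"
    using sublinear_scale_le[OF assms(1), of "inverse t" "t *\<^sub>R x"] assms(2) by simp
  then have "t * p x \<le> p (t *\<^sub>R x)"
    using False assms(2) by (simp add: field_simps)
  then show ?thesis using sublinear_scale_le[OF assms] by (simp add: antisym)
qed (simp add: sublinear_zero[OF assms(1)])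

lemma le_cINF_add_cINF:
  fixes f :: "'i \<Rightarrow> real" and g :: "'k \<Rightarrow> real"
  assumes "I \<noteq> {}" "K \<noteq> {}" "\<And>i k. i \<in> I \<Longrightarrow> k \<in> K \<Longrightarrow> r \<le> f i + g k"
  shows "r \<le> (INF i\<in>I. f i) + (INF k\<in>K. g k)"
proof -
  have "r - g k \<le> (INF i\<in>I. f i)" if "k \<in> K" for k
    by (rule cINF_greatest[OF assms(1)]) (use assms(3) that in \<open>simp add: algebra_simps\<close>)
  then have "r - (INF i\<in>I. f i) \<le> (INF k\<in>K. g k)"
    by (intro cINF_greatest[OF assms(2)]) (simp add: algebra_simps)
  then show ?thesis by simp
qed

text \<open>The largest sublinear functional below \<open>p\<close> whose value at \<open>- z\<close> is at most \<open>- p z\<close>;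
  every linear functional below it agrees with \<open>p\<close> at \<open>z\<close>.\<close>

definition tilt :: "('a::real_vector \<Rightarrow> real) \<Rightarrow> 'a \<Rightarrow> 'a \<Rightarrow> real" where
  "tilt p z x = (INF s\<in>{0..}. p (x + s *\<^sub>R z) - s * p z)"

context
  fixes p :: "'a::real_vector \<Rightarrow> real" and z :: 'a
  assumes p: "sublinear p"
begin

lemma tilt_le_at: "0 \<le> s \<Longrightarrow> tilt p z x \<le> p (x + s *\<^sub>R z) - s * p z"
  unfolding tilt_def
proof (rule cINF_lower)
  have "- p (- x) \<le> p (x + t *\<^sub>R z) - t * p z" if "0 \<le> t" for t
    using sublinear_add[OF p, of "x + t *\<^sub>R z" "- x"] sublinear_scale[OF p that] by simp
  then show "bdd_below ((\<lambda>s. p (x + s *\<^sub>R z) - s * p z) ` {0..})"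
    by (intro bdd_belowI[where m = "- p (- x)"]) auto
qed simp

lemma tilt_le: "tilt p z x \<le> p x"
  using tilt_le_at[of 0 x] by simp

lemma tilt_neg: "tilt p z (- z) \<le> - p z"
  using tilt_le_at[of 1 "- z"] sublinear_zero[OF p] by simp

lemma sublinear_tilt: "sublinear (tilt p z)"
  unfolding sublinear_def
proof (intro conjI allI impI)
  fix x y :: 'a and t :: real
  show "tilt p z (x + y) \<le> tilt p z x + tilt p z y"
    unfolding tilt_def[of _ _ x] tilt_def[of _ _ y]
  proof (rule le_cINF_add_cINF)
    fix s r :: real assume "s \<in> {0..}" "r \<in> {0..}"
    then have "tilt p z (x + y) \<le> p ((x + y) + (s + r) *\<^sub>R z) - (s + r) * p z"
      by (intro tilt_le_at) simp
    also have "\<dots> \<le> p (x + s *\<^sub>R z) + p (y + r *\<^sub>R z) - (s + r) * p z"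
      using sublinear_add[OF p, of "x + s *\<^sub>R z" "y + r *\<^sub>R z"] by (simp add: algebra_simps)
    finally show "tilt p z (x + y) \<le> p (x + s *\<^sub>R z) - s * p z + (p (y + r *\<^sub>R z) - r * p z)"
      by (simp add: algebra_simps)
  qed auto
  assume t: "0 \<le> t"
  show "tilt p z (t *\<^sub>R x) \<le> t * tilt p z x"
  proof (cases "t = 0")
    case True
    then show ?thesis using tilt_le[of 0] sublinear_zero[OF p] by simp
  next
    case False
    have "tilt p z (t *\<^sub>R x) / t \<le> tilt p z x"
      unfolding tilt_def[of _ _ x]
    proof (rule cINF_greatest)
      fix s :: real assume "s \<in> {0..}"
      then have "tilt p z (t *\<^sub>R x) \<le> p (t *\<^sub>R x + (t * s) *\<^sub>R z) - (t * s) * p z"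
        using t by (intro tilt_le_at) simp
      also have "\<dots> = t * (p (x + s *\<^sub>R z) - s * p z)"
        using sublinear_scale[OF p t, of "x + s *\<^sub>R z"] by (simp add: algebra_simps)
      finally show "tilt p z (t *\<^sub>R x) / t \<le> p (x + s *\<^sub>R z) - s * p z"
        using t False by (simp add: field_simps)
    qed simp
    then show ?thesis using t False by (simp add: field_simps)
  qed
qed

end

text \<open>If \<open>q\<close> is minimal, tilting it towards \<open>y\<close> changes nothing, so that \<open>q (- y) \<le> - q y\<close>; an odd
  sublinear functional is linear.\<close>

lemma minimal_sublinear_linear:
  assumes q: "sublinear q"
    and minimal: "\<And>r. sublinear r \<Longrightarrow> r \<le> q \<Longrightarrow> r = q"
  shows "linear q"
proof -
  have neg: "q (- y) = - q y" for y
  proof -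
    have "tilt q y = q"
      using sublinear_tilt[OF q] tilt_le[OF q] by (intro minimal) (simp_all add: le_fun_def)
    then show ?thesis
      using tilt_neg[OF q, of y] sublinear_neg[OF q, of y] by simp
  qed
  show ?thesis
  proof (rule linearI)
    fix x y :: 'a and t :: real
    show "q (x + y) = q x + q y"
      using sublinear_add[OF q, of x y] sublinear_add[OF q, of "x + y" "- y"] by (simp add: neg)
    show "q (t *\<^sub>R x) = t *\<^sub>R q x"
      using sublinear_scale[OF q, of t x] sublinear_scale[OF q, of "- t" x]
      by (cases "0 \<le> t") (simp_all add: neg)
  qed
qed

lemma sublinear_Inf_chain:
  assumes C: "C \<noteq> {}" "\<And>q. q \<in> C \<Longrightarrow> sublinear q" "\<And>q. q \<in> C \<Longrightarrow> q \<le> p"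
    and chain: "\<And>q r. q \<in> C \<Longrightarrow> r \<in> C \<Longrightarrow> q \<le> r \<or> r \<le> q"
  shows "sublinear (\<lambda>x. INF q\<in>C. q x)"
    and "q \<in> C \<Longrightarrow> (INF q\<in>C. q x) \<le> q x"
proof -
  have lower: "(INF q\<in>C. q x) \<le> q x" if "q \<in> C" for q x
  proof (rule cINF_lower[OF _ that])
    have "- p (- x) \<le> r x" if "r \<in> C" for r
      using sublinear_neg[OF C(2)[OF that], of x] le_funD[OF C(3)[OF that], of "- x"] by simp
    then show "bdd_below ((\<lambda>q. q x) ` C)" by (intro bdd_belowI[where m = "- p (- x)"]) auto
  qed
  then show "q \<in> C \<Longrightarrow> (INF q\<in>C. q x) \<le> q x" .
  show "sublinear (\<lambda>x. INF q\<in>C. q x)"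
    unfolding sublinear_def
  proof (intro conjI allI impI)
    fix x y :: 'a and t :: real
    show "(INF q\<in>C. q (x + y)) \<le> (INF q\<in>C. q x) + (INF q\<in>C. q y)"
    proof (rule le_cINF_add_cINF[OF C(1) C(1)])
      fix q r assume qr: "q \<in> C" "r \<in> C"
      then obtain s where s: "s \<in> C" "s \<le> q" "s \<le> r" using chain by blast
      have "(INF q\<in>C. q (x + y)) \<le> s (x + y)" by (rule lower[OF s(1)])
      also have "\<dots> \<le> s x + s y" by (rule sublinear_add[OF C(2)[OF s(1)]])
      finally show "(INF q\<in>C. q (x + y)) \<le> q x + r y"
        using le_funD[OF s(2), of x] le_funD[OF s(3), of y] by simp
    qed
    assume t: "0 \<le> t"
    show "(INF q\<in>C. q (t *\<^sub>R x)) \<le> t * (INF q\<in>C. q x)"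
    proof (cases "t = 0")
      case True
      obtain q where q: "q \<in> C" using C(1) by blast
      then show ?thesis using True lower[OF q, of 0] sublinear_zero[OF C(2)[OF q]] by simp
    next
      case False
      have "(INF q\<in>C. q (t *\<^sub>R x)) / t \<le> (INF q\<in>C. q x)"
      proof (rule cINF_greatest[OF C(1)])
        fix q assume q: "q \<in> C"
        show "(INF q\<in>C. q (t *\<^sub>R x)) / t \<le> q x"
          using lower[OF q, of "t *\<^sub>R x"] sublinear_scale[OF C(2)[OF q] t, of x] t False
          by (simp add: field_simps)
      qed
      then show ?thesis using t False by (simp add: field_simps)
    qed
  qed
qed

text \<open>The Hahn--Banach theorem, by Zorn's lemma: a chain of sublinear functionals below \<open>p\<close> is
  bounded below by its pointwise infimum, and a minimal sublinear functional is linear.\<close>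

theorem linear_below_sublinear:
  fixes p :: "'a::real_vector \<Rightarrow> real"
  assumes p: "sublinear p"
  obtains f where "linear f" "\<And>x. f x \<le> p x"
proof -
  define A where "A = {q. sublinear q \<and> q \<le> p}"
  have "\<exists>m\<in>A. \<forall>a\<in>A. a \<le> m \<longrightarrow> a = m"
  proof (rule predicate_Zorn)
    show "partial_order_on A (relation_of (\<lambda>a b. b \<le> a) A)"
      by (auto simp: partial_order_on_def preorder_on_def refl_on_def trans_def antisym_def
          relation_of_def)
    fix C assume C: "C \<in> Chains (relation_of (\<lambda>a b. b \<le> a) A)"
    then have CA: "C \<subseteq> A" and chain: "\<And>q r. q \<in> C \<Longrightarrow> r \<in> C \<Longrightarrow> q \<le> r \<or> r \<le> q"
      by (auto simp: Chains_def relation_of_def)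
    show "\<exists>u\<in>A. \<forall>a\<in>C. u \<le> a"
    proof (cases "C = {}")
      case True
      then show ?thesis using p by (auto simp: A_def)
    next
      case False
      have sub: "\<And>q. q \<in> C \<Longrightarrow> sublinear q" and le: "\<And>q. q \<in> C \<Longrightarrow> q \<le> p"
        using CA by (auto simp: A_def)
      let ?u = "\<lambda>x. INF q\<in>C. q x"
      have lower: "\<forall>a\<in>C. ?u \<le> a"
        using sublinear_Inf_chain(2)[OF False sub le chain] by (auto simp: le_fun_def)
      moreover have "?u \<in> A"
        using sublinear_Inf_chain(1)[OF False sub le chain] lower False le
        unfolding A_def by (fastforce intro: order_trans)
      ultimately show ?thesis by blast
    qed
  qed
  then obtain m where m: "sublinear m" "m \<le> p"
    and min: "\<And>a. sublinear a \<Longrightarrow> a \<le> p \<Longrightarrow> a \<le> m \<Longrightarrow> a = m"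
    by (auto simp: A_def)
  have "linear m"
    using m min order_trans by (intro minimal_sublinear_linear) blast+
  then show ?thesis using that m(2) by (auto simp: le_fun_def)
qed

corollary linear_touching_sublinear:
  fixes p :: "'a::real_vector \<Rightarrow> real"
  assumes p: "sublinear p"
  obtains f where "linear f" "\<And>x. f x \<le> p x" "f z = p z"
proof -
  obtain f where f: "linear f" "\<And>x. f x \<le> tilt p z x"
    using linear_below_sublinear[OF sublinear_tilt[OF p]] by blast
  have below: "f x \<le> p x" for x using f(2) tilt_le[OF p] order_trans by blast
  have "p z \<le> f z"
    using f(2)[of "- z"] tilt_neg[OF p, of z] linear_neg[OF f(1), of z] by simp
  then show ?thesis using that[OF f(1) below] below[of z] by simp
qed

section \<open>Square roots and positivity in unital C*-algebras\<close>

text \<open>The Taylor coefficients of \<open>sqrt (1 - t)\<close> at \<open>0\<close>.\<close>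

definition sqrt_coeff :: "nat \<Rightarrow> real" where
  "sqrt_coeff n = (1/2 gchoose n) * (- 1) ^ n"

lemma sqrt_coeff_0 [simp]: "sqrt_coeff 0 = 1"
  by (simp add: sqrt_coeff_def)

lemma sqrt_coeff_Suc: "sqrt_coeff (Suc n) = sqrt_coeff n * (real n - 1/2) / real (Suc n)"
proof -
  have "(1/2 gchoose Suc n) * real (Suc n) = - ((1/2 gchoose n) * (real n - 1/2))"
    using gbinomial_mult_1[of "1/2::real" n] by (simp add: algebra_simps)
  moreover have "sqrt_coeff (Suc n) * real (Suc n)
      = - ((- 1) ^ n * ((1/2 gchoose Suc n) * real (Suc n)))"
    by (simp add: sqrt_coeff_def del: of_nat_Suc)
  ultimately have "sqrt_coeff (Suc n) * real (Suc n) = sqrt_coeff n * (real n - 1/2)"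
    by (simp only: sqrt_coeff_def) simp
  then show ?thesis by (simp add: nonzero_eq_divide_eq del: of_nat_Suc)
qed

lemma sqrt_coeff_Suc_nonpos: "sqrt_coeff (Suc n) \<le> 0"
proof (induction n)
  case 0
  then show ?case by (simp add: sqrt_coeff_Suc)
next
  case (Suc n)
  then show ?case
    by (subst sqrt_coeff_Suc) (auto intro!: divide_nonpos_nonneg mult_nonpos_nonneg)
qed

text \<open>The partial sums at \<open>t = 1\<close> are nonnegative.  As all coefficients after the first are nonpositive,
  this makes the series absolutely convergent on the closed unit ball, boundary included.\<close>

lemma sum_sqrt_coeff: "(\<Sum>n\<le>m. sqrt_coeff n) = - 2 * real (Suc m) * sqrt_coeff (Suc m)"
proof (induction m)
  case 0
  then show ?case by (simp add: sqrt_coeff_Suc)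
next
  case (Suc m)
  have "2 * real (Suc (Suc m)) * sqrt_coeff (Suc (Suc m)) = sqrt_coeff (Suc m) * (2 * real (Suc m) - 1)"
    by (subst sqrt_coeff_Suc) (simp add: field_simps)
  then show ?case using Suc by (simp add: algebra_simps)
qed

lemma sum_sqrt_coeff_tail: "(\<Sum>n<m. \<bar>sqrt_coeff (Suc n)\<bar>) \<le> 1"
proof -
  have "0 \<le> (\<Sum>n\<le>m. sqrt_coeff n)"
    unfolding sum_sqrt_coeff using sqrt_coeff_Suc_nonpos[of m] by (intro mult_nonpos_nonpos) auto
  also have "(\<Sum>n\<le>m. sqrt_coeff n) = 1 + (\<Sum>n<m. sqrt_coeff (Suc n))"
    by (simp add: sum.atMost_shift)
  also have "(\<Sum>n<m. sqrt_coeff (Suc n)) = - (\<Sum>n<m. \<bar>sqrt_coeff (Suc n)\<bar>)"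
    using sqrt_coeff_Suc_nonpos by (simp add: abs_of_nonpos sum_negf)
  finally show ?thesis by simp
qed

lemma summable_sqrt_coeff_Suc: "summable (\<lambda>n. \<bar>sqrt_coeff (Suc n)\<bar>)"
  by (rule bounded_imp_summable[where B = 1])
     (use sum_sqrt_coeff_tail[of "Suc _"] in \<open>simp_all add: lessThan_Suc_atMost\<close>)

lemma suminf_sqrt_coeff_le: "(\<Sum>n. \<bar>sqrt_coeff (Suc n)\<bar>) \<le> 1"
  using summable_sqrt_coeff_Suc sum_sqrt_coeff_tail by (rule suminf_le_const)

lemma summable_sqrt_coeff: "summable (\<lambda>n. \<bar>sqrt_coeff n\<bar>)"
  using summable_sqrt_coeff_Suc summable_Suc_iff[of "\<lambda>n. \<bar>sqrt_coeff n\<bar>"] by simp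

text \<open>By Vandermonde's identity the formal square of the series is \<open>1 - t\<close>.\<close>

lemma sqrt_coeff_convolution:
  "(\<Sum>i\<le>n. sqrt_coeff i * sqrt_coeff (n - i)) = (if n = 0 then 1 else if n = 1 then - 1 else 0)"
proof -
  have "(\<Sum>i\<le>n. sqrt_coeff i * sqrt_coeff (n - i))
      = (\<Sum>i\<le>n. (1/2 gchoose i) * (1/2 gchoose (n - i))) * (- 1) ^ n"
    unfolding sqrt_coeff_def sum_distrib_right
    by (rule sum.cong) (auto simp: power_add[symmetric])
  also have "\<dots> = (1 gchoose n) * (- 1) ^ n"
    using gbinomial_Vandermonde[of "1/2::real" "1/2" n] by (simp add: atMost_atLeast0)
  also have "(1::real) gchoose n = of_nat (1 choose n)"
    by (simp add: binomial_gbinomial)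
  finally show ?thesis by (cases n) (auto simp: binomial_eq_0)
qed

lemma star_one [simp]: "star (1::'a::unital_cstar_algebra) = 1"
  by (metis mult_1_left mult_1_right star_mult star_star)

lemma norm_one_le: "norm (1::'a::unital_cstar_algebra) \<le> 1"
proof -
  have "norm (1::'a) = (norm (1::'a))\<^sup>2" using cstar_identity[of "1::'a"] by simp
  then have "norm (1::'a) = 0 \<or> norm (1::'a) = 1" by (simp add: power2_eq_square)
  then show ?thesis by auto
qed

lemma norm_power_le_one:
  fixes x :: "'a::unital_cstar_algebra"
  assumes "norm x \<le> 1" shows "norm (x ^ n) \<le> 1"
proof (induction n)
  case (Suc n)
  then show ?case
    using order_trans[OF norm_mult_ineq[of x "x ^ n"]] mult_mono[OF assms Suc] by simp
qed (simp add: norm_one_le)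

lemma star_power: "star (x ^ n) = star x ^ (n::nat)" for x :: "'a::unital_cstar_algebra"
  by (induction n) (simp_all add: power_commutes)

lemma bounded_linear_star: "bounded_linear (star :: 'a::cstar_algebra \<Rightarrow> 'a)"
  by (rule bounded_linear_intro[where K = 1]) simp_all

text \<open>The square root of \<open>x\<close>, as the binomial series of \<open>sqrt (1 - t)\<close> at \<open>t = 1 - x\<close>.  It converges
  for \<open>norm (1 - x) \<le> 1\<close> and replaces the continuous functional calculus throughout.\<close>

definition root_series :: "'a::unital_cstar_algebra \<Rightarrow> 'a" where
  "root_series x = (\<Sum>n. sqrt_coeff n *\<^sub>R (1 - x) ^ n)"

context
  fixes x :: "'a::unital_cstar_algebra"
  assumes x: "norm (1 - x) \<le> 1"
begin

lemma norm_root_series_term: "norm (sqrt_coeff n *\<^sub>R (1 - x) ^ n) \<le> \<bar>sqrt_coeff n\<bar>"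
  using norm_power_le_one[OF x, of n] by (simp add: mult_left_le)

lemma summable_norm_root_series: "summable (\<lambda>n. norm (sqrt_coeff n *\<^sub>R (1 - x) ^ n))"
  using norm_root_series_term by (intro summable_comparison_test[OF _ summable_sqrt_coeff]) auto

lemmas summable_root_series = summable_norm_cancel[OF summable_norm_root_series]

lemma root_series_square: "root_series x * root_series x = x"
proof -
  let ?c = "\<lambda>n::nat. if n = 0 then 1 else if n = 1 then - 1 else (0::real)"
  have "(\<lambda>n. \<Sum>i\<le>n. (sqrt_coeff i *\<^sub>R (1 - x) ^ i) * (sqrt_coeff (n - i) *\<^sub>R (1 - x) ^ (n - i)))
      sums (root_series x * root_series x)"
    unfolding root_series_def
    by (rule Cauchy_product_sums) (rule summable_norm_root_series)+
  also have "(\<lambda>n. \<Sum>i\<le>n. (sqrt_coeff i *\<^sub>R (1 - x) ^ i) * (sqrt_coeff (n - i) *\<^sub>R (1 - x) ^ (n - i)))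
      = (\<lambda>n. ?c n *\<^sub>R (1 - x) ^ n)"
  proof
    fix n
    have "(\<Sum>i\<le>n. (sqrt_coeff i *\<^sub>R (1 - x) ^ i) * (sqrt_coeff (n - i) *\<^sub>R (1 - x) ^ (n - i)))
        = (\<Sum>i\<le>n. (sqrt_coeff i * sqrt_coeff (n - i)) *\<^sub>R (1 - x) ^ n)"
      by (rule sum.cong) (auto simp: power_add[symmetric])
    then show "(\<Sum>i\<le>n. (sqrt_coeff i *\<^sub>R (1 - x) ^ i) * (sqrt_coeff (n - i) *\<^sub>R (1 - x) ^ (n - i)))
        = ?c n *\<^sub>R (1 - x) ^ n"
      by (simp only: scaleR_sum_left[symmetric] sqrt_coeff_convolution)
  qed
  finally have "(\<lambda>n. ?c n *\<^sub>R (1 - x) ^ n) sums (root_series x * root_series x)" .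
  moreover have "(\<lambda>n. ?c n *\<^sub>R (1 - x) ^ n) sums (\<Sum>n\<in>{0, 1}. ?c n *\<^sub>R (1 - x) ^ n)"
    by (rule sums_finite) auto
  ultimately show ?thesis using sums_unique2 by fastforce
qed

lemma norm_one_minus_root_series: "norm (1 - root_series x) \<le> 1"
proof -
  have "root_series x = (\<Sum>n. sqrt_coeff (Suc n) *\<^sub>R (1 - x) ^ Suc n) + 1"
    unfolding root_series_def
    using suminf_split_head[OF summable_root_series] by (simp add: algebra_simps)
  then have "norm (1 - root_series x) = norm (\<Sum>n. sqrt_coeff (Suc n) *\<^sub>R (1 - x) ^ Suc n)"
    by simp
  also have "\<dots> \<le> (\<Sum>n. norm (sqrt_coeff (Suc n) *\<^sub>R (1 - x) ^ Suc n))"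
    using summable_norm_root_series summable_Suc_iff[of "\<lambda>n. norm (sqrt_coeff n *\<^sub>R (1 - x) ^ n)"]
    by (intro summable_norm) blast
  also have "\<dots> \<le> (\<Sum>n. \<bar>sqrt_coeff (Suc n)\<bar>)"
    using norm_root_series_term summable_sqrt_coeff_Suc summable_norm_root_series
      summable_Suc_iff[of "\<lambda>n. norm (sqrt_coeff n *\<^sub>R (1 - x) ^ n)"]
    by (intro suminf_le) blast+
  also have "\<dots> \<le> 1" by (rule suminf_sqrt_coeff_le)
  finally show ?thesis .
qed

lemma star_root_series: "star x = x \<Longrightarrow> star (root_series x) = root_series x"
  unfolding root_series_def
  by (subst bounded_linear.suminf[OF bounded_linear_star summable_root_series])
     (simp add: star_power)

end

text \<open>Besides the case \<open>x = y\<close>, in which the root commutes with whatever commutes with \<open>x\<close>, this is used to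
  pass between functions of \<open>star c * c\<close> and of \<open>c * star c\<close>.\<close>

lemma root_series_intertwines:
  fixes x y c :: "'a::unital_cstar_algebra"
  assumes "norm (1 - x) \<le> 1" "norm (1 - y) \<le> 1" and xy: "x * c = c * y"
  shows "root_series x * c = c * root_series y"
proof -
  have "(1 - x) ^ n * c = c * (1 - y) ^ n" for n
  proof (induction n)
    case (Suc n)
    have "(1 - x) ^ Suc n * c = (1 - x) * (c * (1 - y) ^ n)"
      by (simp add: mult.assoc Suc)
    also have "\<dots> = ((1 - x) * c) * (1 - y) ^ n" by (simp add: mult.assoc)
    also have "(1 - x) * c = c * (1 - y)" by (simp add: left_diff_distrib right_diff_distrib xy)
    finally show ?case by (simp add: mult.assoc)
  qed simp
  then have "(\<lambda>n. sqrt_coeff n *\<^sub>R (1 - x) ^ n * c) = (\<lambda>n. c * sqrt_coeff n *\<^sub>R (1 - y) ^ n)"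
    by simp
  then show ?thesis
    unfolding root_series_def
    using suminf_mult2[OF summable_root_series[OF assms(1)], of c]
      suminf_mult[OF summable_root_series[OF assms(2)], of c] by simp
qed

text \<open>For hermitian \<open>x\<close> the norm condition says that the spectrum lies in the interval from \<open>0\<close> to \<open>2 t\<close>.
  In this form the triangle inequality shows at once that positive elements form a cone.\<close>

definition positive :: "'a::unital_cstar_algebra \<Rightarrow> bool" where
  "positive x \<longleftrightarrow> star x = x \<and> (\<exists>t. norm (t *\<^sub>R 1 - x) \<le> t)"

lemma positive_add: "positive x \<Longrightarrow> positive y \<Longrightarrow> positive (x + y)"
  unfolding positive_def
proof (elim conjE exE, intro conjI)
  fix s t assume "norm (s *\<^sub>R 1 - x) \<le> s" "norm (t *\<^sub>R 1 - y) \<le> t"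
  then show "\<exists>t. norm (t *\<^sub>R 1 - (x + y)) \<le> t"
    using norm_triangle_ineq[of "s *\<^sub>R 1 - x" "t *\<^sub>R 1 - y"]
    by (intro exI[of _ "s + t"]) (simp add: algebra_simps)
qed simp

lemma positive_scaleR: "positive x \<Longrightarrow> 0 \<le> r \<Longrightarrow> positive (r *\<^sub>R x)"
  unfolding positive_def
proof (elim conjE exE, intro conjI)
  fix t assume "0 \<le> r" "norm (t *\<^sub>R 1 - x) \<le> t"
  moreover have "(r * t) *\<^sub>R 1 - r *\<^sub>R x = r *\<^sub>R (t *\<^sub>R 1 - x)" by (simp add: algebra_simps)
  ultimately show "\<exists>t. norm (t *\<^sub>R 1 - r *\<^sub>R x) \<le> t"
    by (intro exI[of _ "r * t"]) (simp add: mult_left_mono)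
qed simp

lemma positive_root_series:
  "norm (1 - x) \<le> 1 \<Longrightarrow> star x = x \<Longrightarrow> positive (root_series x)"
  unfolding positive_def
  using norm_one_minus_root_series star_root_series by (intro conjI exI[of _ 1]) auto

lemma positive_square_root:
  assumes "positive x"
  obtains h where "star h = h" "h * h = x" "\<And>d. x * d = d * x \<Longrightarrow> h * d = d * h"
proof -
  obtain t where t: "norm (t *\<^sub>R 1 - x) \<le> t" and sx: "star x = x"
    using assms by (auto simp: positive_def)
  show ?thesis
  proof (cases "t = 0")
    case True
    then show ?thesis using t that[of 0] by simp
  next
    case False
    then have t0: "t > 0" using t norm_ge_zero order_trans by (metis less_eq_real_def)
    let ?y = "inverse t *\<^sub>R x"
    have "1 - ?y = inverse t *\<^sub>R (t *\<^sub>R 1 - x)" using t0 by (simp add: scaleR_diff_right)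
    then have "norm (1 - ?y) = norm (t *\<^sub>R 1 - x) / t" using t0 by (simp add: divide_inverse)
    then have y: "norm (1 - ?y) \<le> 1" using t t0 by simp
    show ?thesis
    proof (rule that)
      show "star (sqrt t *\<^sub>R root_series ?y) = sqrt t *\<^sub>R root_series ?y"
        using star_root_series[OF y] sx by simp
      show "sqrt t *\<^sub>R root_series ?y * sqrt t *\<^sub>R root_series ?y = x"
      proof -
        have "sqrt t * (sqrt t * inverse t) = 1" using t0 by (simp flip: mult.assoc)
        then show ?thesis using root_series_square[OF y] by simp
      qed
      show "sqrt t *\<^sub>R root_series ?y * d = d * sqrt t *\<^sub>R root_series ?y" if "x * d = d * x" for d
        using root_series_intertwines[OF y y, of d] that by simp
    qed
  qed
qed

text \<open>As \<open>h\<close> and \<open>k\<close> commute, \<open>h * h + k * k\<close> is \<open>star u * u\<close> for \<open>u = h + \<i> *\<^sub>C k\<close>, and \<open>h\<close> is the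
  hermitian part of \<open>u\<close>.  This inequality takes the place of spectral arguments below.\<close>

lemma norm_commuting_squares:
  fixes h k :: "'a::cstar_algebra"
  assumes h: "star h = h" and k: "star k = k" and hk: "h * k = k * h"
  shows "(norm h)\<^sup>2 \<le> norm (h * h + k * k)"
proof -
  let ?u = "h + \<i> *\<^sub>C k"
  have "star ?u * ?u = h * h + k * k"
    by (simp add: h k hk algebra_simps scaleC_diff_right)
  then have u: "(norm ?u)\<^sup>2 = norm (h * h + k * k)" by (simp add: cstar_identity[symmetric])
  have "?u + star ?u = 2 *\<^sub>R h" by (simp add: h k scaleR_2)
  then have "2 * norm h \<le> 2 * norm ?u"
    using norm_triangle_ineq[of ?u "star ?u"] norm_star[of ?u] by (metis abs_numeral mult_2 norm_scaleR)
  then show ?thesis unfolding u[symmetric] by (simp add: power_mono)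
qed

lemma norm_hermitian_square: "star h = h \<Longrightarrow> norm (h * h) = (norm h)\<^sup>2" for h :: "'a::cstar_algebra"
  using cstar_identity[of h] by simp

text \<open>With the root \<open>k\<close> of \<open>1 - h * h\<close> one has \<open>h * h + k * k = 1\<close>, which bounds \<open>k\<close>.\<close>

lemma norm_one_minus_square:
  fixes h :: "'a::unital_cstar_algebra"
  assumes h: "star h = h" "norm h \<le> 1"
  shows "norm (1 - h * h) \<le> 1"
proof -
  let ?x = "1 - h * h"
  have x: "norm (1 - ?x) \<le> 1"
    using norm_hermitian_square[OF h(1)] h(2) by (simp add: power_le_one)
  let ?k = "root_series ?x"
  have kk: "?k * ?k = ?x" by (rule root_series_square[OF x])
  have "?k * h = h * ?k" by (rule root_series_intertwines[OF x x]) (simp add: algebra_simps)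
  moreover have "star ?k = ?k" using star_root_series[OF x] h by simp
  ultimately have "(norm ?k)\<^sup>2 \<le> norm (?k * ?k + h * h)"
    using h(1) by (intro norm_commuting_squares) auto
  then have "(norm ?k)\<^sup>2 \<le> 1" using norm_one_le[where 'a='a] by (simp add: kk)
  then show ?thesis
    using norm_mult_ineq[of ?k ?k] by (simp add: kk power2_eq_square)
qed

lemma positive_square:
  fixes h :: "'a::unital_cstar_algebra"
  assumes h: "star h = h" shows "positive (h * h)"
proof (cases "h = 0")
  case True
  then show ?thesis by (auto simp: positive_def intro: exI[of _ 0])
next
  case False
  define r where "r = inverse (norm h)"
  have "norm (1 - (r *\<^sub>R h) * (r *\<^sub>R h)) \<le> 1"
    using h False by (intro norm_one_minus_square) (simp_all add: r_def)
  then have "positive ((r *\<^sub>R h) * (r *\<^sub>R h))"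
    using h unfolding positive_def by (intro conjI exI[of _ 1]) auto
  then have "positive ((norm h)\<^sup>2 *\<^sub>R ((r *\<^sub>R h) * (r *\<^sub>R h)))"
    by (rule positive_scaleR) simp
  moreover have "(norm h)\<^sup>2 * (r * r) = 1"
    using False by (simp add: r_def power2_eq_square field_simps)
  ultimately show ?thesis by simp
qed

lemma hermitian_nilpotent:
  fixes h :: "'a::cstar_algebra"
  assumes h: "star h = h" and "h * h * h = 0" shows "h = 0"
proof -
  have "star (h * h) * (h * h) = 0" using assms by (simp add: mult.assoc)
  then have "star h * h = 0" using h by (simp only: star_mult_self_eq_0)
  then show ?thesis by simp
qed

text \<open>For \<open>d = p - m\<close> the product \<open>d * (p + m)\<close> vanishes, so \<open>d * p * d\<close> and \<open>d * m * d\<close>, which are squares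
  of commuting hermitian elements, add up to zero.  Hence both vanish, and with them \<open>d * d * d\<close>.\<close>

lemma positive_square_root_unique:
  fixes p :: "'a::unital_cstar_algebra"
  assumes p: "positive p" and m: "positive m" and pm: "p * m = m * p" and sq: "p * p = m * m"
  shows "p = m"
proof -
  obtain g where g: "star g = g" "g * g = p" and gc: "\<And>d. p * d = d * p \<Longrightarrow> g * d = d * g"
    using positive_square_root[OF p] by metis
  obtain h where h: "star h = h" "h * h = m" and hc: "\<And>d. m * d = d * m \<Longrightarrow> h * d = d * h"
    using positive_square_root[OF m] by metis
  define d where "d = p - m"
  have sd: "star d = d" using p m by (simp add: d_def positive_def)
  have gd: "g * d = d * g" by (rule gc) (simp add: d_def algebra_simps pm)
  have hd: "h * d = d * h" by (rule hc) (simp add: d_def algebra_simps pm)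
  have "g * m = m * g" by (rule gc[OF pm])
  then have gh: "h * g = g * h" by (intro hc) simp
  have "d * (p + m) = 0" by (simp add: d_def algebra_simps sq pm)
  then have "d * p * d + d * m * d = 0"
    by (metis distrib_left distrib_right mult_zero_left)
  moreover have dp: "d * p * d = (g * d) * (g * d)" "d * m * d = (h * d) * (h * d)"
    by (metis g(2) gd mult.assoc) (metis h(2) hd mult.assoc)
  ultimately have z: "(g * d) * (g * d) + (h * d) * (h * d) = 0" by simp
  have comm: "(g * d) * (h * d) = (h * d) * (g * d)"
    by (metis gd hd gh mult.assoc)
  have sg: "star (g * d) = g * d" "star (h * d) = h * d"
    using g h sd gd hd by simp_all
  have "(norm (g * d))\<^sup>2 \<le> 0"
    using norm_commuting_squares[OF sg comm] z by simp
  moreover have "(norm (h * d))\<^sup>2 \<le> 0"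
    using norm_commuting_squares[OF sg(2,1) comm[symmetric]] z by (simp add: add.commute)
  ultimately have "d * p * d = 0" "d * m * d = 0" unfolding dp by auto
  moreover have "d * (p - m) * d = d * p * d - d * m * d"
    by (simp add: left_diff_distrib right_diff_distrib)
  ultimately have "d * d * d = 0" by (simp add: d_def[symmetric])
  then show ?thesis using hermitian_nilpotent[OF sd] by (simp add: d_def)
qed

lemma positive_root_series_square:
  fixes p :: "'a::unital_cstar_algebra"
  assumes p: "positive p" "norm p \<le> 1" shows "root_series (p * p) = p"
proof -
  have sp: "star p = p" using p by (simp add: positive_def)
  have n: "norm (1 - p * p) \<le> 1" using norm_one_minus_square[OF sp p(2)] .
  show ?thesis
  proof (rule positive_square_root_unique)
    show "positive (root_series (p * p))"
      by (rule positive_root_series[OF n]) (simp add: sp)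
    show "root_series (p * p) * p = p * root_series (p * p)"
      by (rule root_series_intertwines[OF n n]) (simp add: mult.assoc)
  qed (use p root_series_square[OF n] in simp_all)
qed

text \<open>The anticommutator is twice the sum of the squares of the real and the imaginary part of \<open>c\<close>.\<close>

lemma positive_anticommutator:
  fixes c :: "'a::unital_cstar_algebra"
  shows "positive (star c * c + c * star c)"
proof -
  define a where "a = (1/2) *\<^sub>R (c + star c)"
  define b where "b = (\<i> / 2) *\<^sub>C (star c - c)"
  have "positive (a * a + b * b)"
    by (intro positive_add positive_square)
       (simp_all add: a_def b_def add.commute scaleC_diff_right)
  then have "positive (2 *\<^sub>R (a * a + b * b))" by (rule positive_scaleR) simp
  moreover have "2 *\<^sub>R (a * a) = (1/2) *\<^sub>R ((c + star c) * (c + star c))"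
    by (simp add: a_def)
  moreover have "2 *\<^sub>R (b * b) = - ((1/2) *\<^sub>R ((star c - c) * (star c - c)))"
    by (simp add: b_def scaleR_scaleC flip: scaleC_of_real)
  moreover have "(1/2) *\<^sub>R ((c + star c) * (c + star c)) - ((1/2) *\<^sub>R ((star c - c) * (star c - c)))
      = star c * c + c * star c"
    by (simp add: algebra_simps flip: scaleR_add_left)
  ultimately show ?thesis by (simp add: scaleR_add_right)
qed

text \<open>The element \<open>y = c * star c\<close> is positive, being the positive anticommutator plus \<open>p\<close>, and it
  satisfies \<open>y * c = - (c * p)\<close>.  The sign disappears on squaring, so that taking roots of
  \<open>y * y\<close> and \<open>p * p\<close> gives \<open>y * c = c * p\<close> as well, and \<open>c * p = 0\<close>.\<close>

lemma negative_star_mult_zero: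
  fixes c p :: "'a::unital_cstar_algebra"
  assumes p: "positive p" and cc: "star c * c = - p" and nc: "norm c \<le> 1"
  shows "c = 0"
proof -
  define y where "y = c * star c"
  have "y = (star c * c + c * star c) + p" by (simp add: y_def cc)
  then have y: "positive y" using positive_add[OF positive_anticommutator[of c] p] by simp
  have sy: "star y = y" and sp: "star p = p" using y p by (simp_all add: positive_def)
  have ny: "norm y \<le> 1" using cstar_identity[of "star c"] nc by (simp add: y_def power_le_one)
  have "norm p = norm (star c * c)" by (simp add: cc)
  then have np: "norm p \<le> 1" using nc by (simp add: cstar_identity power_le_one)
  have yc: "y * c = - (c * p)" by (simp add: y_def mult.assoc cc)
  have "(y * y) * c = c * (p * p)"
    by (metis yc minus_minus mult.assoc mult_minus_left mult_minus_right)
  then have "root_series (y * y) * c = c * root_series (p * p)"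
    using norm_one_minus_square[OF sy ny] norm_one_minus_square[OF sp np]
    by (intro root_series_intertwines)
  then have "y * c = c * p"
    by (simp add: positive_root_series_square[OF y ny] positive_root_series_square[OF p np])
  then have "c * p = - (c * p)" using yc by simp
  then have "2 *\<^sub>R (c * p) = 0" by (metis add.right_inverse scaleR_2)
  then have "c * p = 0" by simp
  then have "star p * p = 0" using sp cc by (metis minus_mult_left mult.assoc mult_zero_right neg_equal_0_iff_equal)
  then have "star c * c = 0" using cc by simp
  then show ?thesis by simp
qed

text \<open>The theorem of Fukamiya and Kaplansky.  Let \<open>x = star b * b\<close>, let \<open>m\<close> be its absolute value and
  \<open>v = (m - x) / 2\<close> its negative part.  Then \<open>c = b * v\<close> has \<open>star c * c = - (v * v * v)\<close>, which is
  only possible if \<open>c = 0\<close>; hence \<open>v = 0\<close> and \<open>x = m\<close>.\<close>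

theorem positive_star_mult:
  fixes b :: "'a::unital_cstar_algebra"
  shows "positive (star b * b)"
proof -
  have contraction: "positive (star b * b)" if nb: "norm b \<le> 1" for b :: 'a
  proof -
    define x where "x = star b * b"
    have sx: "star x = x" by (simp add: x_def)
    have nx: "norm x \<le> 1" using nb by (simp add: x_def cstar_identity power_le_one)
    note nxx = norm_one_minus_square[OF sx nx]
    define m where "m = root_series (x * x)"
    have mm: "m * m = x * x" unfolding m_def by (rule root_series_square[OF nxx])
    have m: "positive m" unfolding m_def by (rule positive_root_series[OF nxx]) (simp add: sx)
    then have sm: "star m = m" by (simp add: positive_def)
    have mx: "m * x = x * m"
      unfolding m_def by (rule root_series_intertwines[OF nxx nxx]) (simp add: mult.assoc)
    have "(norm m)\<^sup>2 = norm (x * x)" by (simp add: norm_hermitian_square[OF sm, symmetric] mm)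
    also have "\<dots> \<le> 1" using nx by (simp add: norm_hermitian_square[OF sx] power_le_one)
    finally have nm: "norm m \<le> 1" by (simp add: power2_le_imp_le abs_square_le_1)
    define v where "v = (1/2) *\<^sub>R (m - x)"
    have sv: "star v = v" by (simp add: v_def sm sx)
    have nv: "norm v \<le> 1" using norm_triangle_ineq4[of m x] nm nx by (simp add: v_def)
    have mv: "m * v = v * m" by (simp add: v_def algebra_simps mx)
    have vv: "v * v = m * v" "x * v = - (v * v)"
      by (simp_all add: v_def algebra_simps mx mm flip: scaleR_add_left)
    obtain n where n: "star n = n" "n * n = m" and nc: "\<And>d. m * d = d * m \<Longrightarrow> n * d = d * n"
      using positive_square_root[OF m] by metis
    have nv': "n * v = v * n" by (rule nc[OF mv])
    \<comment> \<open>\<open>v * v = m * v\<close> and \<open>m = n * n\<close>, so that the cube of \<open>v\<close> is a square\<close>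
    have "v * v * v = (n * v) * (n * v)"
      by (metis vv(1) n(2) nv' mult.assoc)
    then have vvv: "positive (v * v * v)"
      using positive_square[of "n * v"] n sv nv' by simp
    have "star (b * v) * (b * v) = v * (x * v)" by (simp add: sv x_def mult.assoc)
    also have "\<dots> = - (v * v * v)" by (simp add: vv(2) mult.assoc)
    finally have eq: "star (b * v) * (b * v) = - (v * v * v)" .
    moreover have "norm (b * v) \<le> 1"
      using order_trans[OF norm_mult_ineq mult_mono[OF nb nv]] by simp
    ultimately have "b * v = 0" using negative_star_mult_zero[OF vvv] by blast
    then have "v * v * v = 0" using eq by simp
    then have "v = 0" by (rule hermitian_nilpotent[OF sv])
    then show ?thesis using m by (simp add: v_def x_def)
  qed
  show ?thesis
  proof (cases "b = 0")
    case False
    have "positive ((norm b)\<^sup>2 *\<^sub>R (star (inverse (norm b) *\<^sub>R b) * (inverse (norm b) *\<^sub>R b)))"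
      using False by (intro positive_scaleR contraction) simp_all
    moreover have "(norm b)\<^sup>2 * (inverse (norm b) * inverse (norm b)) = 1"
      using False by (simp add: power2_eq_square field_simps)
    ultimately show ?thesis by simp
  qed (use positive_square[of 0] in simp)
qed

section \<open>Positive functionals\<close>

lemma positive_zero: "positive 0"
  by (auto simp: positive_def intro: exI[of _ 0])

lemma positive_norm_minus:
  fixes x :: "'a::unital_cstar_algebra"
  assumes x: "positive x" shows "positive (norm x *\<^sub>R 1 - x)"
proof (cases "x = 0")
  case False
  obtain h where h: "star h = h" "h * h = x"
    using positive_square_root[OF x] by metis
  define r where "r = inverse (norm h)"
  have hx: "norm x = (norm h)\<^sup>2" using norm_hermitian_square[OF h(1)] h(2) by simp
  have h0: "norm h \<noteq> 0" using h False by auto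
  have "norm (1 - (1 - (r *\<^sub>R h) * (r *\<^sub>R h))) \<le> 1"
    using h0 hx h(2) by (simp add: r_def power2_eq_square field_simps)
  then have "positive (1 - (r *\<^sub>R h) * (r *\<^sub>R h))"
    using h unfolding positive_def by (intro conjI exI[of _ 1]) auto
  then have "positive (norm x *\<^sub>R (1 - (r *\<^sub>R h) * (r *\<^sub>R h)))"
    by (rule positive_scaleR) simp
  moreover have "norm x * (r * r) = 1"
    using h0 by (simp add: hx r_def power2_eq_square field_simps)
  ultimately show ?thesis by (simp add: h(2) scaleR_diff_right)
qed (simp add: positive_zero)

text \<open>Both \<open>z\<close> and \<open>(s - 1) - z\<close>, where \<open>s = norm (1 + z)\<close>, are squares of commuting hermitian elements;
  their sum \<open>s - 1\<close> therefore bounds \<open>norm z\<close>.\<close>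

lemma norm_one_plus_positive:
  fixes z :: "'a::unital_cstar_algebra"
  assumes z: "positive z" "z \<noteq> 0" shows "norm (1 + z) = 1 + norm z"
proof -
  have "(1::'a) \<noteq> 0" using z(2) by (metis mult_1_left mult_zero_left)
  then have n1: "norm (1::'a) = 1"
    using cstar_identity[of "1::'a"] by (simp add: power2_eq_square)
  obtain h where h: "star h = h" "h * h = z" and hc: "\<And>d. z * d = d * z \<Longrightarrow> h * d = d * h"
    using positive_square_root[OF z(1)] by metis
  define s where "s = norm (1 + z)"
  have s1: "1 \<le> s"
    using norm_commuting_squares[of 1 h] h by (simp add: n1 s_def)
  have "positive (1::'a)" using positive_square[of "1::'a"] by simp
  then have "positive (s *\<^sub>R 1 - (1 + z))"
    unfolding s_def by (intro positive_norm_minus positive_add z(1))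
  then obtain k where k: "star k = k" "k * k = s *\<^sub>R 1 - (1 + z)"
    and kc: "\<And>d. (s *\<^sub>R 1 - (1 + z)) * d = d * (s *\<^sub>R 1 - (1 + z)) \<Longrightarrow> k * d = d * k"
    using positive_square_root by metis
  have "k * z = z * k" by (rule kc) (simp add: algebra_simps)
  then have "(norm h)\<^sup>2 \<le> norm (h * h + k * k)"
    using h k by (intro norm_commuting_squares hc) simp_all
  also have "h * h + k * k = (s - 1) *\<^sub>R 1" by (simp add: h k algebra_simps)
  finally have "norm z \<le> s - 1" using s1 norm_hermitian_square[OF h(1)] by (simp add: h n1)
  then show ?thesis using norm_triangle_ineq[of 1 z] by (simp add: s_def n1)
qed

text \<open>A functional of norm one that takes the value one at the unit is positive; it also norms
  \<open>z\<close> because it norms \<open>1 + z\<close>.\<close>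

lemma norming_real_functional:
  fixes z :: "'a::unital_cstar_algebra"
  assumes z: "positive z" "z \<noteq> 0"
  shows "\<exists>f. linear f \<and> (\<forall>x. f x \<le> norm x) \<and> (\<forall>x. positive x \<longrightarrow> 0 \<le> f x) \<and> f z = norm z"
proof -
  have "sublinear (norm :: 'a \<Rightarrow> real)" by (simp add: sublinear_def norm_triangle_ineq)
  then obtain f :: "'a \<Rightarrow> real"
    where f: "linear f" "\<And>x. f x \<le> norm x" and top: "f (1 + z) = norm (1 + z)"
    using linear_touching_sublinear by blast
  have "f 1 + f z = 1 + norm z"
    using top norm_one_plus_positive[OF z] by (simp add: linear_add[OF f(1)])
  then have f1: "f 1 = 1" and fz: "f z = norm z"
    using f(2)[of 1] f(2)[of z] norm_one_le[where 'a='a] by linarith+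
  have "0 \<le> f x" if x: "positive x" for x
  proof -
    obtain t where t: "norm (t *\<^sub>R 1 - x) \<le> t" using x by (auto simp: positive_def)
    then have "f (t *\<^sub>R 1 - x) \<le> t" using f(2) order_trans by blast
    then show ?thesis by (simp add: linear_diff[OF f(1)] linear_scale[OF f(1)] f1)
  qed
  then show ?thesis using f fz by blast
qed

definition positive_functional :: "'a::cstar_algebra dual \<Rightarrow> bool" where
  "positive_functional \<phi> \<longleftrightarrow> (\<forall>x. dapply \<phi> (star x) = cnj (dapply \<phi> x)) \<and>
     (\<forall>x. 0 \<le> Re (dapply \<phi> (star x * x)))"

lemma positive_functional_star: "positive_functional \<phi> \<Longrightarrow> dapply \<phi> (star x) = cnj (dapply \<phi> x)"
  and positive_functional_nonneg: "positive_functional \<phi> \<Longrightarrow> 0 \<le> Re (dapply \<phi> (star x * x))"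
  by (simp_all add: positive_functional_def)

text \<open>The real functional is first made hermitian by averaging over \<open>x\<close> and \<open>star x\<close>; a real-linear
  \<open>g\<close> is the real part of the complex-linear \<open>\<lambda>x. g x - \<i> * g (\<i> *\<^sub>C x)\<close>.\<close>

lemma complexify_functional:
  fixes f :: "'a::unital_cstar_algebra \<Rightarrow> real"
  assumes f: "linear f" and K: "0 \<le> K" and bound: "\<And>x. f x \<le> K * norm x"
    and pos: "\<And>x. positive x \<Longrightarrow> 0 \<le> f x"
  shows "\<exists>\<phi>::'a dual. positive_functional \<phi> \<and> norm \<phi> \<le> 2 * K \<and>
    (\<forall>x. star x = x \<longrightarrow> dapply \<phi> x = of_real (f x))"
proof -
  define g where "g x = f ((1/2) *\<^sub>R (x + star x))" for x
  have g_add: "g (x + y) = g x + g y" for x y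
  proof -
    have "(1/2) *\<^sub>R ((x + y) + star (x + y)) = (1/2) *\<^sub>R (x + star x) + (1/2) *\<^sub>R (y + star y)"
      by (simp add: scaleR_add_right)
    then show ?thesis by (simp only: g_def linear_add[OF f])
  qed
  have g_scale: "g (r *\<^sub>R x) = r * g x" for r x
  proof -
    have "(1/2) *\<^sub>R (r *\<^sub>R x + star (r *\<^sub>R x)) = r *\<^sub>R (1/2) *\<^sub>R (x + star x)"
      by (simp add: scaleR_add_right)
    then show ?thesis by (simp only: g_def linear_scale[OF f] real_scaleR_def)
  qed
  have g_diff: "g (x - y) = g x - g y" for x y
    using g_add[of "x - y" y] by simp
  have g_neg: "g (- x) = - g x" for x using g_scale[of "- 1" x] by simp
  have g_star: "g (star x) = g x" for x by (simp add: g_def add.commute)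
  have g_bound: "\<bar>g x\<bar> \<le> K * norm x" for x
  proof -
    have le: "g y \<le> K * norm y" for y
    proof -
      have "norm ((1/2) *\<^sub>R (y + star y)) \<le> norm y"
        using norm_triangle_ineq[of y "star y"] by simp
      then show ?thesis
        unfolding g_def using bound mult_left_mono[OF _ K] order_trans by blast
    qed
    show ?thesis using le[of x] le[of "- x"] by (simp add: g_neg)
  qed
  define F where "F x = Complex (g x) (- g (\<i> *\<^sub>C x))" for x
  have F_add: "F (x + y) = F x + F y" for x y
    by (simp add: F_def g_add scaleC_add_right complex_eq_iff)
  have F_scale: "F (c *\<^sub>C x) = c * F x" for c x
  proof -
    have dec: "k *\<^sub>C x = Re k *\<^sub>R x + Im k *\<^sub>R (\<i> *\<^sub>C x)" for k
    proof -
      have "k = of_real (Re k) + of_real (Im k) * \<i>" by (simp add: complex_eq_iff)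
      then have "k *\<^sub>C x = (of_real (Re k) + of_real (Im k) * \<i>) *\<^sub>C x" by simp
      also have "\<dots> = Re k *\<^sub>R x + Im k *\<^sub>R (\<i> *\<^sub>C x)"
        by (simp add: scaleC_add_left scaleR_scaleC scaleC_of_real)
      finally show ?thesis .
    qed
    have "g (c *\<^sub>C x) = Re c * g x + Im c * g (\<i> *\<^sub>C x)"
      by (subst dec) (simp add: g_add g_scale)
    moreover have "g (\<i> *\<^sub>C c *\<^sub>C x) = Re c * g (\<i> *\<^sub>C x) - Im c * g x"
      by (subst scaleC_scaleC, subst dec) (simp add: g_diff g_scale)
    ultimately show ?thesis by (simp add: F_def complex_eq_iff algebra_simps)
  qed
  have F_bound: "cmod (F x) \<le> 2 * K * norm x" for x
    using cmod_le[of "F x"] g_bound[of x] g_bound[of "\<i> *\<^sub>C x"] by (simp add: F_def)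
  define \<phi> where "\<phi> = Dual F"
  have \<phi>: "dapply \<phi> x = F x" for x
    unfolding \<phi>_def using F_add F_scale F_bound by (rule Dual_apply)
  have hermitian: "dapply \<phi> x = of_real (f x)" if "star x = x" for x
  proof -
    have "x + star x = 2 *\<^sub>R x" by (simp add: that scaleR_2)
    then have "g x = f x" by (simp add: g_def)
    moreover have "g (\<i> *\<^sub>C x) = 0" by (simp add: g_def that linear_0[OF f])
    ultimately show ?thesis by (simp add: \<phi> F_def complex_eq_iff)
  qed
  have "dapply \<phi> (star x) = cnj (dapply \<phi> x)" for x
  proof -
    have "g (\<i> *\<^sub>C star x) = - g (\<i> *\<^sub>C x)"
      using g_star[of "\<i> *\<^sub>C x"] g_neg[of "\<i> *\<^sub>C star x"] by simp
    then show ?thesis by (simp add: \<phi> F_def g_star complex_eq_iff)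
  qed
  then have "positive_functional \<phi>"
    unfolding positive_functional_def by (simp add: hermitian pos positive_star_mult)
  moreover have "norm \<phi> \<le> 2 * K"
    using K by (intro norm_dual_le) (simp_all add: \<phi> F_bound)
  ultimately show ?thesis using hermitian by blast
qed

corollary norming_functional:
  fixes c :: "'a::unital_cstar_algebra"
  assumes "c \<noteq> 0"
  obtains \<phi> where "positive_functional \<phi>" "norm \<phi> \<le> 2" "dapply \<phi> (star c * c) = (norm c)\<^sup>2"
proof -
  have "star c * c \<noteq> 0" using assms by simp
  then obtain f :: "'a \<Rightarrow> real" where f: "linear f" "\<And>x. f x \<le> norm x"
    "\<And>x. positive x \<Longrightarrow> 0 \<le> f x" "f (star c * c) = norm (star c * c)"
    using norming_real_functional[OF positive_star_mult] by metis
  have bound: "f x \<le> 1 * norm x" for x using f(2) by simp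
  obtain \<phi> where \<phi>: "positive_functional \<phi>" "norm \<phi> \<le> 2 * 1"
    "\<And>x. star x = x \<Longrightarrow> dapply \<phi> x = of_real (f x)"
    using complexify_functional[OF f(1) zero_le_one bound f(3)] by metis
  then have "dapply \<phi> (star c * c) = (norm c)\<^sup>2" using f(4) by (simp add: cstar_identity)
  then show ?thesis using \<phi>(1,2) by (intro that[of \<phi>]) simp_all
qed

text \<open>A substitute for a weak-star cluster point: the upper limit of the real parts is sublinear, and a
  linear functional below it takes the limit value wherever the sequence is eventually constant.\<close>

lemma cluster_functional:
  fixes \<psi> :: "nat \<Rightarrow> 'a::unital_cstar_algebra dual"
  assumes pos: "\<And>n. positive_functional (\<psi> n)" and bound: "\<And>n. norm (\<psi> n) \<le> K"
  shows "\<exists>\<phi>. positive_functional \<phi> \<and>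
    (\<forall>x r. star x = x \<longrightarrow> eventually (\<lambda>n. dapply (\<psi> n) x = of_real r) sequentially
      \<longrightarrow> dapply \<phi> x = of_real r)"
proof -
  have K: "0 \<le> K" using order_trans[OF norm_ge_zero bound] .
  have re_bound: "\<bar>Re (dapply (\<psi> n) x)\<bar> \<le> K * norm x" for n x
    using order_trans[OF abs_Re_le_cmod order_trans[OF dapply_bound mult_right_mono[OF bound]]]
    by simp
  \<comment> \<open>the infimum of \<open>S x\<close> is the upper limit of the real parts at \<open>x\<close>\<close>
  define S where "S x = {r. eventually (\<lambda>n. Re (dapply (\<psi> n) x) \<le> r) sequentially}" for x
  define p where "p x = Inf (S x)" for x
  have S_lower: "- (K * norm x) \<le> r" if "r \<in> S x" for x r
  proof -
    have "eventually (\<lambda>n. Re (dapply (\<psi> n) x) \<le> r) sequentially" using that by (simp add: S_def)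
    then obtain n where "Re (dapply (\<psi> n) x) \<le> r"
      using eventually_happens sequentially_bot by blast
    then show ?thesis using re_bound[of n x] by linarith
  qed
  have S_upper: "K * norm x \<in> S x" for x
    using abs_le_D1[OF re_bound] by (simp add: S_def)
  have S_bdd: "bdd_below (S x)" for x using S_lower by (intro bdd_belowI) blast
  have p_le: "p x \<le> r" if "r \<in> S x" for x r
    unfolding p_def using that S_bdd by (rule cInf_lower)
  have "sublinear p"
    unfolding sublinear_def
  proof (intro conjI allI impI)
    fix x y :: 'a and t :: real
    have "p (x + y) \<le> (INF r\<in>S x. r) + (INF r\<in>S y. r)"
    proof (rule le_cINF_add_cINF)
      fix r s assume "r \<in> S x" "s \<in> S y"
      then have "eventually (\<lambda>n. Re (dapply (\<psi> n) x) \<le> r \<and> Re (dapply (\<psi> n) y) \<le> s) sequentially"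
        by (simp add: S_def eventually_conj_iff)
      then have "r + s \<in> S (x + y)"
        unfolding S_def by (auto elim!: eventually_mono)
      then show "p (x + y) \<le> r + s" by (rule p_le)
    qed (use S_upper in auto)
    then show "p (x + y) \<le> p x + p y" by (simp add: p_def)
    assume t: "0 \<le> t"
    show "p (t *\<^sub>R x) \<le> t * p x"
    proof (cases "t = 0")
      case True
      then show ?thesis using p_le[OF S_upper[of 0]] by simp
    next
      case False
      have "p (t *\<^sub>R x) / t \<le> p x"
        unfolding p_def[of x]
      proof (rule cInf_greatest)
        fix r assume "r \<in> S x"
        then have "t * r \<in> S (t *\<^sub>R x)"
          unfolding S_def using t by (auto elim!: eventually_mono intro: mult_left_mono)
        then show "p (t *\<^sub>R x) / t \<le> r"
          using p_le[of "t * r"] t False by (simp add: field_simps)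
      qed (use S_upper in auto)
      then show ?thesis using t False by (simp add: field_simps)
    qed
  qed
  then obtain f where f: "linear f" "\<And>x. f x \<le> p x" using linear_below_sublinear by blast
  have f_le: "f x \<le> r" if "r \<in> S x" for x r using f(2) p_le[OF that] order_trans by blast
  have f_pos: "0 \<le> f x" if x: "positive x" for x
  proof -
    obtain h where "star h = h" "h * h = x" using positive_square_root[OF x] by metis
    then have "0 \<le> Re (dapply (\<psi> n) x)" for n using positive_functional_nonneg[OF pos, of n h] by simp
    then have "0 \<in> S (- x)" by (auto simp: S_def)
    then show ?thesis using f_le linear_neg[OF f(1), of x] by fastforce
  qed
  obtain \<phi> where \<phi>: "positive_functional \<phi>"
    "\<And>x. star x = x \<Longrightarrow> dapply \<phi> x = of_real (f x)"
    using complexify_functional[OF f(1) K f_le[OF S_upper] f_pos] by metis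
  have "dapply \<phi> x = of_real r"
    if x: "star x = x" and ev: "eventually (\<lambda>n. dapply (\<psi> n) x = of_real r) sequentially" for x r
  proof -
    have "r \<in> S x" "- r \<in> S (- x)"
      unfolding S_def using ev by (auto elim!: eventually_mono)
    then have "f x = r" using f_le[of r x] f_le[of "- r" "- x"] linear_neg[OF f(1), of x] by simp
    then show ?thesis using \<phi>(2)[OF x] by simp
  qed
  then show ?thesis using \<phi>(1) by blast
qed

section \<open>Positive functionals on the bidual\<close>

lemma nonneg_quadratic_discriminant:
  fixes A B E :: real
  assumes q: "\<And>t. 0 \<le> t\<^sup>2 * A + 2 * t * B + E" and A: "0 \<le> A"
  shows "B\<^sup>2 \<le> A * E"
proof (cases "A = 0")
  case True
  have "B = 0"
  proof (rule ccontr)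
    assume "B \<noteq> 0"
    then have "2 * (- (E + 1) / (2 * B)) * B = - (E + 1)" by simp
    then show False using q[of "- (E + 1) / (2 * B)"] unfolding True by linarith
  qed
  then show ?thesis using True by simp
next
  case False
  have "0 \<le> A * ((- B / A)\<^sup>2 * A + 2 * (- B / A) * B + E)"
    using q[of "- B / A"] A by simp
  also have "\<dots> = A * E - B\<^sup>2" using False by (simp add: power2_eq_square field_simps)
  finally show ?thesis by simp
qed

context
  fixes \<phi> :: "'a::cstar_algebra dual"
  assumes \<phi>: "positive_functional \<phi>"
begin

abbreviation (input) sq :: "'a \<Rightarrow> real" where
  "sq a \<equiv> Re (dapply \<phi> (star a * a))"

lemma sq_le: "sq a \<le> norm \<phi> * (norm a)\<^sup>2"
  using order_trans[OF complex_Re_le_cmod dapply_bound[of \<phi> "star a * a"]]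
  by (simp add: cstar_identity)

lemma sq_add_scale: "sq (z + t *\<^sub>R a) = sq z + 2 * t * Re (dapply \<phi> (star a * z)) + t\<^sup>2 * sq a"
proof -
  have "dapply \<phi> (star z * a) = cnj (dapply \<phi> (star a * z))"
    using positive_functional_star[OF \<phi>, of "star a * z"] by simp
  then show ?thesis by (simp add: algebra_simps power2_eq_square)
qed

text \<open>The discriminant bounds the real part of \<open>F\<close>; multiplying \<open>a\<close> by a phase that makes \<open>F a\<close> real and
  nonnegative turns this into a bound of the modulus.\<close>

lemma conjugate_homogeneous_bound:
  assumes F: "\<And>c a. F (c *\<^sub>C a) = cnj c * F a"
    and q: "\<And>t a. 0 \<le> t\<^sup>2 * sq a + 2 * t * Re (F a) + E"
  shows "(cmod (F a))\<^sup>2 \<le> sq a * E"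
proof -
  have re: "(Re (F b))\<^sup>2 \<le> sq b * E" for b
    using q positive_functional_nonneg[OF \<phi>] by (rule nonneg_quadratic_discriminant)
  define c where "c = cnj (of_real (cmod (F a)) / F a)"
  show ?thesis
  proof (cases "F a = 0")
    case True
    then show ?thesis using re[of a] by simp
  next
    case False
    have "cnj c * c = 1"
    proof -
      have "cmod c = 1" using False by (simp add: c_def norm_divide)
      then show ?thesis by (metis complex_norm_square mult.commute of_real_1 one_power2)
    qed
    then have "star (c *\<^sub>C a) * (c *\<^sub>C a) = star a * a" by (simp add: mult.commute)
    moreover have "F (c *\<^sub>C a) = of_real (cmod (F a))" using False by (simp add: F c_def)
    ultimately show ?thesis using re[of "c *\<^sub>C a"] by simp
  qed
qed

lemma positive_functional_Cauchy_Schwarz: "(cmod (dapply \<phi> (star a * b)))\<^sup>2 \<le> sq a * sq b"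
proof (rule conjugate_homogeneous_bound)
  show "0 \<le> t\<^sup>2 * sq a + 2 * t * Re (dapply \<phi> (star a * b)) + sq b" for t a
    using positive_functional_nonneg[OF \<phi>, of "b + t *\<^sub>R a"] unfolding sq_add_scale by simp
qed simp

lemma norm_dual_shift_star: "norm (dual_shift \<phi> (star a)) \<le> sqrt (norm \<phi>) * sqrt (sq a)"
proof (rule norm_dual_le)
  fix b
  have "(cmod (dapply \<phi> (star a * b)))\<^sup>2 \<le> sq a * (norm \<phi> * (norm b)\<^sup>2)"
    using positive_functional_Cauchy_Schwarz[of a b]
      mult_left_mono[OF sq_le[of b] positive_functional_nonneg[OF \<phi>, of a]] by linarith
  then have "cmod (dapply \<phi> (star a * b)) \<le> sqrt (sq a * (norm \<phi> * (norm b)\<^sup>2))"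
    by (rule real_le_rsqrt)
  then show "cmod (dapply (dual_shift \<phi> (star a)) b) \<le> sqrt (norm \<phi>) * sqrt (sq a) * norm b"
    by (simp add: real_sqrt_mult mult.commute mult.left_commute)
qed (simp add: positive_functional_nonneg[OF \<phi>])

text \<open>In the Hilbert space completion for the form \<open>\<phi> (star a * b)\<close>, the bounded conjugate-linear
  functional \<open>\<lambda>a. G (dual_shift \<phi> (star a))\<close> is represented by a vector.  An element \<open>z\<close> that nearly
  minimises \<open>\<phi> (star z * z) - 2 * Re (G (dual_shift \<phi> (star z)))\<close> approximates this vector well
  enough, and no completion is needed.\<close>

lemma approximate_Riesz_vector:
  assumes \<delta>: "0 < \<delta>"
  obtains z where "\<And>a. (cmod (dapply \<phi> (star a * z) - dapply G (dual_shift \<phi> (star a))))\<^sup>2 \<le> sq a * \<delta>\<^sup>2"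
proof -
  define L where "L a = dapply G (dual_shift \<phi> (star a))" for a
  define Q where "Q z = sq z - 2 * Re (L z)" for z
  define M where "M = norm G * sqrt (norm \<phi>)"
  have L_bound: "cmod (L a) \<le> M * sqrt (sq a)" for a
    using order_trans[OF dapply_bound mult_left_mono[OF norm_dual_shift_star[of a], of "norm G"]]
    by (simp add: L_def M_def mult.assoc)
  have "- M\<^sup>2 \<le> Q z" for z
  proof -
    have "Re (L z) \<le> M * sqrt (sq z)"
      using complex_Re_le_cmod L_bound order_trans by blast
    moreover have "0 \<le> (sqrt (sq z) - M)\<^sup>2" by simp
    ultimately show ?thesis
      using positive_functional_nonneg[OF \<phi>, of z]
      by (simp add: Q_def power2_diff algebra_simps)
  qed
  then have bdd: "bdd_below (range Q)" by (intro bdd_belowI) auto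
  have "Inf (range Q) < Inf (range Q) + \<delta>\<^sup>2" using \<delta> by simp
  then obtain z where z: "Q z < Inf (range Q) + \<delta>\<^sup>2"
    using cInf_lessD[of "range Q"] by blast
  have near: "0 \<le> t\<^sup>2 * sq a + 2 * t * Re (dapply \<phi> (star a * z) - L a) + \<delta>\<^sup>2" for t a
  proof -
    have "L (t *\<^sub>R a) = of_real t * L a"
      by (simp add: L_def dual_shift_linear flip: scaleC_of_real)
    then have "Re (L (z + t *\<^sub>R a)) = Re (L z) + t * Re (L a)"
      by (simp add: L_def dual_shift_linear)
    moreover have "Q z - \<delta>\<^sup>2 \<le> Q (z + t *\<^sub>R a)"
      using z cInf_lower[OF rangeI bdd, of "z + t *\<^sub>R a"] by linarith
    ultimately show ?thesis unfolding Q_def sq_add_scale by (simp add: algebra_simps)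
  qed
  have "(cmod (dapply \<phi> (star a * z) - L a))\<^sup>2 \<le> sq a * \<delta>\<^sup>2" for a
    using near
    by (intro conjugate_homogeneous_bound[where F = "\<lambda>a. dapply \<phi> (star a * z) - L a"])
       (simp_all add: L_def dual_shift_linear right_diff_distrib)
  then show ?thesis using that unfolding L_def by blast
qed

text \<open>If \<open>\<zeta>\<close> is the vector that represents \<open>G\<close>, the value is the square of its norm.  With \<open>z\<close>
  in place of \<open>\<zeta>\<close>, the errors are of order \<open>\<delta>\<close>.\<close>

lemma positive_functional_enveloping:
  "0 \<le> Re (dapply (arens_mult (enveloping_star G) G) \<phi>)"
proof -
  define l where "l = dual_star (arens_act G \<phi>)"
  define M where "M = norm G * sqrt (norm \<phi>)"
  have l: "dapply l a = cnj (dapply G (dual_shift \<phi> (star a)))" for a by (simp add: l_def)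
  have "- (\<delta>\<^sup>2 + M * \<delta>) \<le> Re (dapply G l)" if \<delta>: "0 < \<delta>" for \<delta>
  proof -
    obtain z where z: "\<And>a. (cmod (dapply \<phi> (star a * z) - dapply G (dual_shift \<phi> (star a))))\<^sup>2 \<le> sq a * \<delta>\<^sup>2"
      using approximate_Riesz_vector[OF \<delta>] by blast
    have z': "cmod (dapply \<phi> (star a * z) - dapply G (dual_shift \<phi> (star a))) \<le> sqrt (sq a) * \<delta>" for a
      using real_le_rsqrt[OF z[of a]] \<delta> by (simp add: real_sqrt_mult)
    have "norm (l - dual_shift \<phi> (star z)) \<le> sqrt (norm \<phi>) * \<delta>"
    proof (rule norm_dual_le)
      fix a
      have "dapply \<phi> (star z * a) = cnj (dapply \<phi> (star a * z))"
        using positive_functional_star[OF \<phi>, of "star a * z"] by simp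
      then have "dapply (l - dual_shift \<phi> (star z)) a
          = - cnj (dapply \<phi> (star a * z) - dapply G (dual_shift \<phi> (star a)))"
        by (simp add: l)
      then have "cmod (dapply (l - dual_shift \<phi> (star z)) a) \<le> sqrt (sq a) * \<delta>"
        using z'[of a] by (simp only: norm_minus_cancel complex_mod_cnj)
      also have "\<dots> \<le> sqrt (norm \<phi> * (norm a)\<^sup>2) * \<delta>"
        using \<delta> sq_le[of a] by (intro mult_right_mono) auto
      finally show "cmod (dapply (l - dual_shift \<phi> (star z)) a) \<le> sqrt (norm \<phi>) * \<delta> * norm a"
        by (simp add: real_sqrt_mult mult.commute mult.left_commute)
    qed (use \<delta> in simp)
    then have "cmod (dapply G (l - dual_shift \<phi> (star z))) \<le> M * \<delta>"
      using order_trans[OF dapply_bound mult_left_mono, of "l - dual_shift \<phi> (star z)" _ G]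
      by (simp only: M_def mult.assoc norm_ge_zero)
    then have "- (M * \<delta>) \<le> Re (dapply G (l - dual_shift \<phi> (star z)))"
      using abs_Re_le_cmod[of "dapply G (l - dual_shift \<phi> (star z))"] by linarith
    moreover have "- \<delta>\<^sup>2 \<le> Re (dapply G (dual_shift \<phi> (star z)))"
    proof -
      have "sq z - Re (dapply G (dual_shift \<phi> (star z))) \<le> sqrt (sq z) * \<delta>"
        using order_trans[OF complex_Re_le_cmod z'[of z]] by simp
      moreover have "sqrt (sq z) * \<delta> \<le> sq z + \<delta>\<^sup>2 / 4"
        using zero_le_power2[of "sqrt (sq z) - \<delta> / 2"] positive_functional_nonneg[OF \<phi>, of z]
        by (simp add: power2_diff power_divide)
      ultimately show ?thesis using zero_le_power2[of \<delta>] by linarith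
    qed
    ultimately show ?thesis by simp
  qed
  then have "eventually (\<lambda>\<delta>. - (\<delta>\<^sup>2 + M * \<delta>) \<le> Re (dapply G l)) (at_right 0)"
    by (simp add: eventually_at_right_less eventually_mono[OF eventually_at_right_less])
  moreover have "((\<lambda>\<delta>. - (\<delta>\<^sup>2 + M * \<delta>)) \<longlongrightarrow> - (0\<^sup>2 + M * 0)) (at_right 0)"
    by (intro tendsto_intros)
  ultimately have "- (0\<^sup>2 + M * 0) \<le> Re (dapply G l)"
    by (intro tendsto_upperbound[where F = "at_right (0::real)"]) simp_all
  then show ?thesis by (simp add: l_def)
qed

end

lemma enveloping_le_apply:
  assumes "positive_functional \<phi>" "F \<le>\<^sub>*\<^sub>* G"
  shows "Re (dapply F \<phi>) \<le> Re (dapply G \<phi>)"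
proof -
  obtain H where "G - F = arens_mult (enveloping_star H) H"
    using assms(2) unfolding enveloping_le_def by blast
  then have "0 \<le> Re (dapply (G - F) \<phi>)"
    using positive_functional_enveloping[OF assms(1), of H] by simp
  then show ?thesis by simp
qed

section \<open>Local units for countable sets\<close>

lemma bounded_linear_of_alg: "bounded_linear (of_alg :: 'a::cstar_algebra \<Rightarrow> 'a unitalization)"
proof (rule bounded_linear_intro[where K = 1])
  show "of_alg (r *\<^sub>R x) = r *\<^sub>R of_alg x" for r and x :: 'a
    using of_alg_scaleC[of "of_real r" x] by (simp add: scaleC_of_real)
qed (simp_all add: of_alg_add)

lemma of_alg_eq_0_iff: "of_alg a = 0 \<longleftrightarrow> a = 0"
  using norm_of_alg[of a] by (metis norm_eq_zero)

text \<open>A local unit \<open>h\<close> of a convergent series \<open>\<Sum>n. r n *\<^sub>R (x n * star (x n))\<close> with \<open>r n > 0\<close> serves all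
  \<open>x n\<close>.  For \<open>q = 1 - h\<close>, the compression of the series by \<open>q\<close> is zero and has the
  summands \<open>r n\<close> times \<open>(q * x n) * star (q * x n)\<close>, which every positive functional sends to
  nonnegative numbers; hence all of these are annihilated, although a functional norming a nonzero
  one would exist.\<close>

lemma countable_local_unit:
  fixes C :: "'a::cstar_algebra set"
  assumes lu: "locally_unital TYPE('a)" and C: "countable C"
  shows "\<exists>h. star h = h \<and> (\<forall>x\<in>C. h * x = x)"
proof (cases "C = {}")
  case True
  then show ?thesis by (intro exI[of _ 0]) simp
next
  case False
  define x where "x = from_nat_into C"
  define r where "r n = (1/2) ^ n / (1 + (norm (x n))\<^sup>2)" for n
  define u where "u n = r n *\<^sub>R (x n * star (x n))" for n
  have r: "0 < r n" for n by (simp add: r_def add_pos_nonneg)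
  have "norm (u n) \<le> (1/2) ^ n" for n
  proof -
    have "norm (x n * star (x n)) = (norm (x n))\<^sup>2" using cstar_identity[of "star (x n)"] by simp
    then have "norm (u n) = (1/2) ^ n * ((norm (x n))\<^sup>2 / (1 + (norm (x n))\<^sup>2))"
      using r[of n] by (simp add: u_def r_def)
    also have "\<dots> \<le> (1/2) ^ n * 1"
      by (intro mult_left_mono) (simp_all add: divide_le_eq_1 add_pos_nonneg)
    finally show ?thesis by simp
  qed
  then have summable: "summable u"
    by (intro summable_comparison_test[where f = u and g = "\<lambda>n. (1/2) ^ n"]) auto
  obtain h where h: "local_unit h (suminf u)" using lu unfolding locally_unital_def by blast
  then have sh: "star h = h" and ha: "h * suminf u = suminf u" by (simp_all add: local_unit_def)
  define q where "q = 1 - of_alg h"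
  have q: "q * of_alg t = of_alg (t - h * t)" for t
    by (simp add: q_def left_diff_distrib of_alg_mult of_alg_diff)
  have "h * x n = x n" for n
  proof (rule ccontr)
    assume "h * x n \<noteq> x n"
    define d where "d k = star (of_alg (x k)) * star q" for k
    have sd: "star (d k) = q * of_alg (x k)" for k by (simp add: d_def)
    have "d n \<noteq> 0"
    proof
      assume "d n = 0"
      then have "q * of_alg (x n) = 0" using sd[of n] by simp
      then show False using \<open>h * x n \<noteq> x n\<close> unfolding q by (simp add: of_alg_eq_0_iff)
    qed
    then obtain \<phi> where \<phi>: "positive_functional \<phi>" and \<phi>d: "dapply \<phi> (star (d n) * d n) = (norm (d n))\<^sup>2"
      by (rule norming_functional)
    define G where "G t = Re (dapply \<phi> (q * of_alg t * star q))" for t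
    have G: "bounded_linear G"
      unfolding G_def
      by (intro bounded_linear_compose[OF bounded_linear_Re] bounded_linear_compose[OF bounded_linear_dapply]
          bounded_linear_compose[OF bounded_linear_mult_left]
          bounded_linear_compose[OF bounded_linear_mult_right] bounded_linear_of_alg)
    have Gu: "G (u k) = r k * Re (dapply \<phi> (star (d k) * d k))" for k
    proof -
      have "q * of_alg (x k * star (x k)) * star q = star (d k) * d k"
        by (simp add: d_def of_alg_mult of_alg_star mult.assoc)
      then have "G (x k * star (x k)) = Re (dapply \<phi> (star (d k) * d k))" by (simp add: G_def)
      then show ?thesis
        by (simp add: u_def linear_scale[OF bounded_linear.linear[OF G]])
    qed
    have nonneg: "0 \<le> G (u k)" for k
      using r[of k] positive_functional_nonneg[OF \<phi>, of "d k"] by (simp add: Gu)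
    have "(\<Sum>k. G (u k)) = G (suminf u)"
      using bounded_linear.suminf[OF G summable] by simp
    also have "\<dots> = 0"
    proof -
      have "q * of_alg (suminf u) = 0" by (simp add: q ha of_alg_eq_0_iff)
      then show ?thesis by (simp add: G_def)
    qed
    finally have "G (u n) = 0"
      using suminf_eq_zero_iff[OF bounded_linear.summable[OF G summable] nonneg] by simp
    then show False using r[of n] \<open>d n \<noteq> 0\<close> by (simp add: Gu \<phi>d)
  qed
  moreover have "range x = C" unfolding x_def using False C by (rule range_from_nat_into)
  ultimately show ?thesis using sh by blast
qed

section \<open>States supported away from countably many elements of a frame\<close>

definition compress :: "'a::cstar_algebra dual \<Rightarrow> 'a \<Rightarrow> 'a dual" where
  "compress \<phi> b = Dual (\<lambda>t. dapply \<phi> (star b * t * b))"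

lemma compress_bound:
  fixes \<phi> :: "'a::cstar_algebra dual"
  shows "cmod (dapply \<phi> (star b * t * b)) \<le> norm \<phi> * (norm b)\<^sup>2 * norm t"
proof -
  have "norm (star b * t * b) \<le> norm (star b) * norm t * norm b"
    by (rule order_trans[OF norm_mult_ineq mult_right_mono[OF norm_mult_ineq norm_ge_zero]])
  then have "norm \<phi> * norm (star b * t * b) \<le> norm \<phi> * ((norm b)\<^sup>2 * norm t)"
    by (intro mult_left_mono) (simp_all add: power2_eq_square mult.commute mult.left_commute)
  then show ?thesis using order_trans[OF dapply_bound] by (simp add: mult.assoc)
qed

lemma dapply_compress [simp]: "dapply (compress \<phi> b) t = dapply \<phi> (star b * t * b)"
  unfolding compress_def
  by (rule Dual_apply[OF _ _ compress_bound]) (simp_all add: distrib_left distrib_right)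

lemma norm_compress: "norm (compress \<phi> b) \<le> norm \<phi> * (norm b)\<^sup>2"
  by (rule norm_dual_le) (simp_all add: compress_bound)

lemma positive_functional_compress:
  assumes "positive_functional \<phi>" shows "positive_functional (compress \<phi> b)"
  unfolding positive_functional_def
proof (intro conjI allI)
  fix t
  show "dapply (compress \<phi> b) (star t) = cnj (dapply (compress \<phi> b) t)"
    using positive_functional_star[OF assms, of "star b * t * b"] by (simp add: mult.assoc)
  show "0 \<le> Re (dapply (compress \<phi> b) (star t * t))"
    using positive_functional_nonneg[OF assms, of "t * b"] by (simp add: mult.assoc)
qed

lemma positive_functional_real:
  assumes "positive_functional \<phi>" "star x = x" shows "dapply \<phi> x = of_real (Re (dapply \<phi> x))"
  using positive_functional_star[OF assms(1), of x] assms(2) by (simp add: complex_eq_iff)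

text \<open>The frame condition tested on a positive functional, where ultraweak convergence becomes
  convergence of a series of nonnegative numbers.\<close>

lemma frame_lower_bound:
  fixes xs :: "'j \<Rightarrow> 'a::cstar_algebra"
  assumes "nonstandard_frame self_ip J xs"
  shows "\<exists>c>0. \<forall>a \<phi>. positive_functional \<phi> \<longrightarrow>
    (\<exists>s. ((\<lambda>j. Re (dapply \<phi> (of_alg (star a * (xs j * star (xs j)) * a)))) has_sum s) J \<and>
      c * Re (dapply \<phi> (of_alg (star a * a))) \<le> s)"
proof -
  obtain c1 c2 :: real where c: "c1 > 0" and fr: "\<And>x. \<exists>T. limitin ultraweak_topology
          (\<lambda>F. canon (\<Sum>j\<in>F. self_ip x (xs j) * self_ip (xs j) x)) T (finite_subsets_at_top J) \<and>
        c1 *\<^sub>R canon (self_ip x x) \<le>\<^sub>*\<^sub>* T \<and> T \<le>\<^sub>*\<^sub>* c2 *\<^sub>R canon (self_ip x x)"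
    using assms unfolding nonstandard_frame_def by blast
  have "\<exists>s. ((\<lambda>j. Re (dapply \<phi> (of_alg (star a * (xs j * star (xs j)) * a)))) has_sum s) J \<and>
        c1 * Re (dapply \<phi> (of_alg (star a * a))) \<le> s" if \<phi>: "positive_functional \<phi>" for a \<phi>
  proof -
    obtain T where T: "limitin ultraweak_topology
          (\<lambda>F. canon (\<Sum>j\<in>F. self_ip a (xs j) * self_ip (xs j) a)) T (finite_subsets_at_top J)"
        "c1 *\<^sub>R canon (self_ip a a) \<le>\<^sub>*\<^sub>* T" using fr by blast
    have ip: "self_ip a (xs j) * self_ip (xs j) a = of_alg (star a * (xs j * star (xs j)) * a)" for j
      by (simp add: self_ip_def of_alg_mult mult.assoc)
    have "((\<lambda>F. dapply \<phi> (\<Sum>j\<in>F. of_alg (star a * (xs j * star (xs j)) * a))) \<longlongrightarrow> dapply T \<phi>)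
        (finite_subsets_at_top J)"
      using T(1) unfolding limitin_ultraweak_iff ip by simp
    then have "((\<lambda>F. \<Sum>j\<in>F. Re (dapply \<phi> (of_alg (star a * (xs j * star (xs j)) * a)))) \<longlongrightarrow> Re (dapply T \<phi>))
        (finite_subsets_at_top J)"
      by (drule_tac tendsto_Re)
        (simp add: linear_sum[OF bounded_linear.linear[OF bounded_linear_dapply]])
    moreover have "c1 * Re (dapply \<phi> (of_alg (star a * a))) \<le> Re (dapply T \<phi>)"
      using enveloping_le_apply[OF \<phi> T(2)] by (simp add: self_ip_def)
    ultimately show ?thesis unfolding has_sum_def by blast
  qed
  then show ?thesis by (intro exI[of _ c1] conjI c) (intro allI impI)
qed

text \<open>A local unit \<open>h\<close> for all \<open>xs j\<close> with \<open>j \<in> C\<close> is not a unit, so some \<open>y - h * y\<close> is nonzero, and it is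
  orthogonal to these \<open>xs j\<close>.  Normalised, it gives a vector \<open>b\<close>, and \<open>\<psi>\<close> is the compression to
  \<open>b\<close> of a functional that norms \<open>b\<close>.  The frame series of \<open>b\<close> converges,
  so that only countably many of its terms are nonzero.\<close>

lemma escaping_state:
  fixes xs :: "'j \<Rightarrow> 'a::cstar_algebra"
  assumes nonunital: "\<not> unital TYPE('a)" and lu: "locally_unital TYPE('a)"
    and summable: "\<And>a \<phi>. positive_functional \<phi> \<Longrightarrow>
      (\<lambda>j. Re (dapply \<phi> (of_alg (star a * (xs j * star (xs j)) * a)))) summable_on J"
    and C: "countable C"
  shows "\<exists>\<psi> b. positive_functional \<psi> \<and> norm \<psi> \<le> 2 \<and> dapply \<psi> 1 = 1 \<and>
    (\<forall>h t. star h = h \<longrightarrow> h * b = b \<longrightarrow> dapply \<psi> (of_alg h * t * of_alg h) = dapply \<psi> t) \<and>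
    (\<forall>j\<in>C. dapply \<psi> (of_alg (xs j * star (xs j))) = 0) \<and>
    countable {j \<in> J. dapply \<psi> (of_alg (xs j * star (xs j))) \<noteq> 0}"
proof -
  obtain h where sh: "star h = h" and h: "\<And>j. j \<in> C \<Longrightarrow> h * xs j = xs j"
    using countable_local_unit[OF lu countable_image[OF C, of xs]] by blast
  have "\<exists>y. h * y \<noteq> y"
  proof (rule ccontr)
    assume "\<nexists>y. h * y \<noteq> y"
    then have l: "h * y = y" for y by blast
    have "y * h = y" for y using arg_cong[OF l[of "star y"], of star] sh by simp
    then show False using l nonunital unfolding unital_def by blast
  qed
  then obtain y where y: "h * y \<noteq> y" by blast
  define b where "b = inverse (norm (y - h * y)) *\<^sub>R (y - h * y)"
  have nb: "norm b = 1" using y by (simp add: b_def)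
  have orth: "star (xs j) * b = 0" if "j \<in> C" for j
  proof -
    have "star (xs j) * h = star (xs j)" using arg_cong[OF h[OF that], of star] sh by simp
    then have "star (xs j) * (y - h * y) = 0"
      by (simp add: right_diff_distrib mult.assoc[symmetric])
    then show ?thesis by (simp add: b_def)
  qed
  have "of_alg b \<noteq> 0" using nb by (metis norm_of_alg norm_zero zero_neq_one)
  then obtain \<phi> where \<phi>: "positive_functional \<phi>" "norm \<phi> \<le> 2"
    and one: "dapply \<phi> (star (of_alg b) * of_alg b) = (norm (of_alg b))\<^sup>2"
    by (rule norming_functional)
  define \<psi> where "\<psi> = compress \<phi> (of_alg b)"
  have \<psi>: "positive_functional \<psi>" unfolding \<psi>_def by (rule positive_functional_compress[OF \<phi>(1)])
  have \<psi>_alg: "dapply \<psi> (of_alg t) = dapply \<phi> (of_alg (star b * t * b))" for t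
    by (simp add: \<psi>_def of_alg_mult of_alg_star)
  show ?thesis
  proof (intro exI[of _ \<psi>] exI[of _ b] conjI allI impI ballI)
    show "positive_functional \<psi>" by (rule \<psi>)
    show "norm \<psi> \<le> 2"
      using norm_compress[of \<phi> "of_alg b"] \<phi>(2) by (simp add: \<psi>_def nb)
    show "dapply \<psi> 1 = 1" using one by (simp add: \<psi>_def nb)
    show "dapply \<psi> (of_alg g * t * of_alg g) = dapply \<psi> t" if g: "star g = g" "g * b = b" for g t
    proof -
      have r: "of_alg g * of_alg b = of_alg b" using g(2) by (simp flip: of_alg_mult)
      moreover have "star (of_alg b) * of_alg g = star (of_alg b)"
        using arg_cong[OF r, of star] g(1) by (simp flip: of_alg_star)
      ultimately have "star (of_alg b) * (of_alg g * t * of_alg g) * of_alg b = star (of_alg b) * t * of_alg b"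
        by (metis mult.assoc)
      then show ?thesis by (simp add: \<psi>_def)
    qed
    show "dapply \<psi> (of_alg (xs j * star (xs j))) = 0" if "j \<in> C" for j
    proof -
      have "star b * (xs j * star (xs j)) * b = 0" by (simp add: mult.assoc orth[OF that])
      then show ?thesis by (simp add: \<psi>_alg of_alg_eq_0_iff[THEN iffD2])
    qed
    have "countable {j \<in> J. Re (dapply \<phi> (of_alg (star b * (xs j * star (xs j)) * b))) \<noteq> 0}"
      by (rule summable_countable_real[OF summable[OF \<phi>(1)]])
    moreover have "dapply \<psi> (of_alg (xs j * star (xs j)))
        = of_real (Re (dapply \<phi> (of_alg (star b * (xs j * star (xs j)) * b))))" for j
      unfolding \<psi>_alg[symmetric] by (intro positive_functional_real[OF \<psi>]) (simp flip: of_alg_star)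
    ultimately show "countable {j \<in> J. dapply \<psi> (of_alg (xs j * star (xs j))) \<noteq> 0}" by simp
  qed
qed

section \<open>Nonexistence of frames\<close>

theorem theorem5p1:
  assumes "\<not> unital TYPE('a::cstar_algebra)"
    and "locally_unital TYPE('a)"
  shows "\<not> (\<exists>(J :: 'j set) (xs :: 'j \<Rightarrow> 'a).
    standard_frame self_ip J xs \<or> nonstandard_frame self_ip J xs)"
proof
  assume "\<exists>(J :: 'j set) (xs :: 'j \<Rightarrow> 'a).
    standard_frame self_ip J xs \<or> nonstandard_frame self_ip J xs"
  then obtain J :: "'j set" and xs :: "'j \<Rightarrow> 'a" where nf: "nonstandard_frame self_ip J xs"
    using standard_frame_imp_nonstandard_frame by blast
  obtain c where c: "c > 0" and frame: "\<forall>a \<phi>. positive_functional \<phi> \<longrightarrow>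
      (\<exists>s. ((\<lambda>j. Re (dapply \<phi> (of_alg (star a * (xs j * star (xs j)) * a)))) has_sum s) J \<and>
        c * Re (dapply \<phi> (of_alg (star a * a))) \<le> s)"
    using frame_lower_bound[OF nf] by (elim exE conjE)
  define supp where "supp \<psi> = {j \<in> J. dapply \<psi> (of_alg (xs j * star (xs j))) \<noteq> 0}" for \<psi>
  have summable: "(\<lambda>j. Re (dapply \<phi> (of_alg (star a * (xs j * star (xs j)) * a)))) summable_on J"
    if "positive_functional \<phi>" for a \<phi>
    using frame that unfolding summable_on_def by blast
  define escapes where "escapes C \<psi> b \<longleftrightarrow> positive_functional \<psi> \<and> norm \<psi> \<le> 2 \<and> dapply \<psi> 1 = 1 \<and>
    (\<forall>h t. star h = h \<longrightarrow> h * b = b \<longrightarrow> dapply \<psi> (of_alg h * t * of_alg h) = dapply \<psi> t) \<and>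
    (\<forall>j\<in>C. dapply \<psi> (of_alg (xs j * star (xs j))) = 0) \<and> countable (supp \<psi>)" for C \<psi> b
  have "\<exists>\<psi> b. escapes C \<psi> b" if "countable C" for C
    unfolding escapes_def supp_def by (rule escaping_state[OF assms summable that])
  then obtain \<Psi> B where escapes: "\<And>C. countable C \<Longrightarrow> escapes C (\<Psi> C) (B C)" by metis
  note \<Psi> = escapes[unfolded escapes_def]
  \<comment> \<open>each state avoids the indices that any earlier state sees\<close>
  define C where "C = rec_nat {} (\<lambda>_ D. D \<union> supp (\<Psi> D))"
  have C_Suc: "C (Suc n) = C n \<union> supp (\<Psi> (C n))" for n by (simp add: C_def)
  have C: "countable (C n)" for n
  proof (induction n)
    case 0
    show ?case by (simp add: C_def)
  next
    case (Suc n)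
    then have "countable (supp (\<Psi> (C n)))" using \<Psi> by blast
    with Suc show ?case by (simp add: C_Suc)
  qed
  have C_mono: "C m \<subseteq> C n" if "m \<le> n" for m n
    using that by (rule lift_Suc_mono_le[rotated]) (simp add: C_Suc)
  obtain h where sh: "star h = h" and h: "\<And>n. h * B (C n) = B (C n)"
    using countable_local_unit[OF assms(2), of "range (\<lambda>n. B (C n))"] by auto
  have shift: "dapply (\<Psi> (C n)) (of_alg h * t * of_alg h) = dapply (\<Psi> (C n)) t" for n t
    using \<Psi>[OF C[of n]] sh h[of n] by metis
  from cluster_functional[of "\<lambda>n. \<Psi> (C n)", OF \<Psi>[OF C, THEN conjunct1]
      \<Psi>[OF C, THEN conjunct2, THEN conjunct1]]
  obtain \<phi> where \<phi>: "positive_functional \<phi>"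
    and cluster: "\<forall>x r. star x = x
      \<longrightarrow> eventually (\<lambda>n. dapply (\<Psi> (C n)) x = of_real r) sequentially \<longrightarrow> dapply \<phi> x = of_real r"
    by blast
  \<comment> \<open>no mass of the states is lost in the limit, because \<open>h\<close> is a unit for all of them\<close>
  have "dapply \<phi> (of_alg (star h * h)) = of_real 1"
  proof (rule cluster[rule_format])
    show "eventually (\<lambda>n. dapply (\<Psi> (C n)) (of_alg (star h * h)) = of_real 1) sequentially"
      using shift[of _ 1] \<Psi>[OF C] by (simp add: sh of_alg_mult)
  qed (simp flip: of_alg_star)
  \<comment> \<open>every index is seen by at most one of the states, hence not by the limit\<close>
  moreover have zero: "Re (dapply \<phi> (of_alg (star h * (xs j * star (xs j)) * h))) = 0" if j: "j \<in> J" for j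
  proof -
    have "eventually (\<lambda>n. dapply (\<Psi> (C n)) (of_alg (xs j * star (xs j))) = 0) sequentially"
    proof (cases "\<exists>m. j \<in> supp (\<Psi> (C m))")
      case True
      then obtain m where "j \<in> C (Suc m)" using C_Suc by blast
      then show ?thesis
        using C_mono \<Psi>[OF C] by (intro eventually_sequentiallyI[of "Suc m"]) blast
    next
      case False
      then show ?thesis using j by (simp add: supp_def)
    qed
    then have "eventually (\<lambda>n. dapply (\<Psi> (C n)) (of_alg (star h * (xs j * star (xs j)) * h)) = of_real 0)
        sequentially"
      using shift[of _ "of_alg (xs j * star (xs j))"] by (simp add: sh of_alg_mult)
    then have "dapply \<phi> (of_alg (star h * (xs j * star (xs j)) * h)) = of_real 0"
      by (rule cluster[rule_format, rotated]) (simp add: mult.assoc flip: of_alg_star)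
    then show ?thesis by simp
  qed
  moreover obtain s where s: "((\<lambda>j. Re (dapply \<phi> (of_alg (star h * (xs j * star (xs j)) * h)))) has_sum s) J"
      "c * Re (dapply \<phi> (of_alg (star h * h))) \<le> s"
    using frame \<phi> by blast
  ultimately have "c \<le> s" by simp
  have "s = 0" using s(1) zero by (rule has_sum_unique[OF _ has_sum_0])
  then show False using c \<open>c \<le> s\<close> by simp
qed

end
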